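(* Let $G$ be a finite group and let $\mathcal D$ be a collection of subgroups of $G$. For every $x\in\Omega(G,\mathcal D)$ and every $N\in\mathcal D\cap\operatorname{NS}(G)$, $$s_N(x)=\operatorname{coeffsum}_{G/N}(x^N).$$ In particular, if $u\in\Omega(G,\mathcal D)^{\times}$, then $$s_N(u)=\frac{1}{|G/N|}\sum_{gN\in G/N}\varphi_{\langle gN\rangle}^{\mathcal D_{\geq N}/N}(u^N)\in\{-1,0,1\}.$$
   Context: For a finite group $G$, $\Omega(G)$ is the Burnside ring (Grothendieck ring of finite $G$-sets under disjoint union and Cartesian product), with $\mathbb Z$-basis $[G/H]$, $(H)$ running over the conjugacy classes of subgroups of $G$, and identity $1_{\Omega(G)}=[G/G]$. $\operatorname{NS}(G)$ is the set of normal subgroups of $G$. A collection $\mathcal D$ of $G$ is a set of subgroups of $G$ containing $G$ and closed under $G$-conjugation and under pairwise intersection; $\mathcal D^c$ is the set of $G$-conjugacy classes $(H)$ with $H\in\mathcal D$. The partial Burnside ring $\Omega(G,\mathcal D)=\bigoplus_{(H)\in\mathcal D^c}\mathbb Z[G/H]$ is a unital subring of $\Omega(G)$. For any subgroup $K\le G$ (not necessarily in $\mathcal D$), the mark $\varphi_K^{\mathcal D}:\Omega(G,\mathcal D)\to\mathbb Z$ is the ring homomorphism $[X]\mapsto\#X^K$. For $x=\sum_{(H)\in\mathcal D^c}a_H[G/H]$ put $\operatorname{coeffsum}_G(x)=\sum_{(H)}a_H$. With $\operatorname{core}_G(H)=\bigcap_{g\in G}gHg^{-1}$ (which lies in $\mathcal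 D\cap\operatorname{NS}(G)$ if $H\in\mathcal D$), for $N\in\mathcal D\cap\operatorname{NS}(G)$ put $c_N(x)=\sum_{(H)\in\mathcal D^c,\ \operatorname{core}_G(H)=N}a_H$ and $s_N(x)=\sum_{M\in\mathcal D\cap\operatorname{NS}(G),\ N\le M}c_M(x)$. $\mathcal D_{\ge N}/N:=\{H/N\mid H\in\mathcal D,\ N\le H\}$ is a collection of $G/N$, and $x\mapsto x^N$ denotes the unital ring homomorphism $\Omega(G,\mathcal D)\to\Omega(G/N,\mathcal D_{\ge N}/N)$, $[X]\mapsto[X^N]$ (where $X^N$ is regarded as a $G/N$-set). *)

theory Defs
  imports
    Complex_Main
    "HOL-Algebra.Group_Action" "HOL-Algebra.Left_Coset"
    "HOL-Algebra.Generated_Groups" "HOL-Algebra.Ring"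
begin

record ('g, 'x) gset =
  points :: "'x set"
  action :: "'g \<Rightarrow> 'x \<Rightarrow> 'x"

definition finite_gset :: "('g, 'm) monoid_scheme \<Rightarrow> ('g, 'x) gset \<Rightarrow> bool" where
  "finite_gset G X \<longleftrightarrow> finite (points X) \<and> group_action G (points X) (action X)"

definition gset_iso ::
  "('g, 'm) monoid_scheme \<Rightarrow> ('g, 'x) gset \<Rightarrow> ('g, 'y) gset \<Rightarrow> bool" where
  "gset_iso G X Y \<longleftrightarrow>
     (\<exists>f. bij_betw f (points X) (points Y) \<and>
          (\<forall>g\<in>carrier G. \<forall>x\<in>points X. f (action X g x) = action Y g (f x)))"

text \<open>
  Library group actions map into permutations that are extensional, i.e. undefined
  off the set acted on, hence the restrictions below.
\<close>

definition gset_empty :: "('g, 'x) gset" where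
  "gset_empty = \<lparr>points = {}, action = (\<lambda>g. \<lambda>x\<in>{}. x)\<rparr>"

definition gset_sum :: "('g, 'x) gset \<Rightarrow> ('g, 'y) gset \<Rightarrow> ('g, 'x + 'y) gset" where
  "gset_sum X Y =
     \<lparr>points = points X <+> points Y,
      action = (\<lambda>g. \<lambda>z\<in>points X <+> points Y. map_sum (action X g) (action Y g) z)\<rparr>"

definition gset_prod :: "('g, 'x) gset \<Rightarrow> ('g, 'y) gset \<Rightarrow> ('g, 'x \<times> 'y) gset" where
  "gset_prod X Y =
     \<lparr>points = points X \<times> points Y,
      action = (\<lambda>g. \<lambda>z\<in>points X \<times> points Y. map_prod (action X g) (action Y g) z)\<rparr>"

definition coset_gset :: "('g, 'm) monoid_scheme \<Rightarrow> 'g set \<Rightarrow> ('g, 'g set) gset" where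
  "coset_gset G H =
     \<lparr>points = lcosets\<^bsub>G\<^esub> H, action = (\<lambda>g. \<lambda>A\<in>lcosets\<^bsub>G\<^esub> H. g <#\<^bsub>G\<^esub> A)\<rparr>"

definition fixed_points :: "('g, 'x) gset \<Rightarrow> 'g set \<Rightarrow> 'x set" where
  "fixed_points X K = {x \<in> points X. \<forall>g\<in>K. action X g x = x}"

text \<open>
  For \<open>N\<close> normal in \<open>G\<close>, the \<open>G Mod N\<close>-set of \<open>N\<close>-fixed points: a coset \<open>C\<close> acts as
  any of its elements does.
\<close>

definition fixed_gset ::
  "('g, 'm) monoid_scheme \<Rightarrow> 'g set \<Rightarrow> ('g, 'x) gset \<Rightarrow> ('g set, 'x) gset" where
  "fixed_gset G N X =
     \<lparr>points = fixed_points X N,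
      action = (\<lambda>C. \<lambda>x\<in>fixed_points X N. the_elem ((\<lambda>g. action X g x) ` C))\<rparr>"

text \<open>
  Elements of the Grothendieck ring are equivalence classes of pairs of finite
  \<open>G\<close>-sets, \<open>(X, Y)\<close> standing for the difference \<open>[X] - [Y]\<close>. Every finite \<open>G\<close>-set is
  isomorphic to one whose points are natural numbers, so the classes collect such
  pairs only; \<open>virtual_class G X Y\<close> is nevertheless defined for \<open>X\<close> and \<open>Y\<close> over
  arbitrary types.
\<close>

type_synonym 'g burnside = "(('g, nat) gset \<times> ('g, nat) gset) set"

definition virtual_class ::
  "('g, 'm) monoid_scheme \<Rightarrow> ('g, 'x) gset \<Rightarrow> ('g, 'y) gset \<Rightarrow> 'g burnside" where
  "virtual_class G X Y =
     {(X', Y'). finite_gset G X' \<and> finite_gset G Y' \<and>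
        (\<exists>Z :: ('g, nat) gset. finite_gset G Z \<and>
           gset_iso G (gset_sum (gset_sum X Y') Z) (gset_sum (gset_sum X' Y) Z))}"

definition gset_class :: "('g, 'm) monoid_scheme \<Rightarrow> ('g, 'x) gset \<Rightarrow> 'g burnside" where
  "gset_class G X = virtual_class G X (gset_empty :: ('g, nat) gset)"

text \<open>
  Operations on classes are computed on representatives: the images under
  \<open>the_elem\<close> are singletons because the operations respect the equivalence
  (and, for \<open>transitive_class\<close>, conjugate subgroups have isomorphic coset sets).
\<close>

definition burnside_ring :: "('g, 'm) monoid_scheme \<Rightarrow> 'g burnside ring" where
  "burnside_ring G =
     \<lparr>carrier = {virtual_class G X Y | (X :: ('g, nat) gset) (Y :: ('g, nat) gset).
                   finite_gset G X \<and> finite_gset G Y},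
      monoid.mult = (\<lambda>A B. the_elem ((\<lambda>((X, Y), (X', Y')).
         virtual_class G (gset_sum (gset_prod X X') (gset_prod Y Y'))
                         (gset_sum (gset_prod X Y') (gset_prod Y X'))) ` (A \<times> B))),
      one = gset_class G (coset_gset G (carrier G)),
      zero = gset_class G (gset_empty :: ('g, nat) gset),
      add = (\<lambda>A B. the_elem ((\<lambda>((X, Y), (X', Y')).
         virtual_class G (gset_sum X X') (gset_sum Y Y')) ` (A \<times> B)))\<rparr>"

definition conj_subgroup :: "('g, 'm) monoid_scheme \<Rightarrow> 'g \<Rightarrow> 'g set \<Rightarrow> 'g set" where
  "conj_subgroup G g H = g <#\<^bsub>G\<^esub> H #>\<^bsub>G\<^esub> (inv\<^bsub>G\<^esub> g)"

definition conj_class :: "('g, 'm) monoid_scheme \<Rightarrow> 'g set \<Rightarrow> 'g set set" where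
  "conj_class G H = {conj_subgroup G g H | g. g \<in> carrier G}"

definition subgroup_core :: "('g, 'm) monoid_scheme \<Rightarrow> 'g set \<Rightarrow> 'g set" where
  "subgroup_core G H = (\<Inter>g\<in>carrier G. conj_subgroup G g H)"

definition collection :: "('g, 'm) monoid_scheme \<Rightarrow> 'g set set \<Rightarrow> bool" where
  "collection G D \<longleftrightarrow>
     (\<forall>H\<in>D. subgroup H G) \<and> carrier G \<in> D \<and>
     (\<forall>H\<in>D. \<forall>g\<in>carrier G. conj_subgroup G g H \<in> D) \<and>
     (\<forall>H\<in>D. \<forall>K\<in>D. H \<inter> K \<in> D)"

definition collection_classes ::
  "('g, 'm) monoid_scheme \<Rightarrow> 'g set set \<Rightarrow> 'g set set set" where
  "collection_classes G D = conj_class G ` D"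

definition quotient_collection ::
  "('g, 'm) monoid_scheme \<Rightarrow> 'g set set \<Rightarrow> 'g set \<Rightarrow> 'g set set set" where
  "quotient_collection G D N = {(\<lambda>h. N #>\<^bsub>G\<^esub> h) ` H | H. H \<in> D \<and> N \<subseteq> H}"

definition transitive_class :: "('g, 'm) monoid_scheme \<Rightarrow> 'g set set \<Rightarrow> 'g burnside" where
  "transitive_class G C = the_elem ((\<lambda>H. gset_class G (coset_gset G H)) ` C)"

definition burnside_comb ::
  "('g, 'm) monoid_scheme \<Rightarrow> 'g set set \<Rightarrow> ('g set set \<Rightarrow> int) \<Rightarrow> 'g burnside" where
  "burnside_comb G D a =
     (\<Oplus>\<^bsub>burnside_ring G\<^esub>C\<in>collection_classes G D.
        [a C] \<cdot>\<^bsub>burnside_ring G\<^esub> transitive_class G C)"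

definition partial_burnside_ring ::
  "('g, 'm) monoid_scheme \<Rightarrow> 'g set set \<Rightarrow> 'g burnside ring" where
  "partial_burnside_ring G D = (burnside_ring G)\<lparr>carrier := range (burnside_comb G D)\<rparr>"

text \<open>
  The coordinates of an element of the partial Burnside ring in its basis, made unique
  as a function by requiring it to be \<open>undefined\<close> off the index set of that basis.
\<close>

definition burnside_coeff ::
  "('g, 'm) monoid_scheme \<Rightarrow> 'g set set \<Rightarrow> 'g burnside \<Rightarrow> 'g set set \<Rightarrow> int" where
  "burnside_coeff G D x =
     (THE a. a \<in> extensional (collection_classes G D) \<and> x = burnside_comb G D a)"

definition coeffsum :: "('g, 'm) monoid_scheme \<Rightarrow> 'g set set \<Rightarrow> 'g burnside \<Rightarrow> int" where
  "coeffsum G D x = (\<Sum>C\<in>collection_classes G D. burnside_coeff G D x C)"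

text \<open>
  The coefficient sums \<open>c\<^sub>N(x)\<close> and \<open>s\<^sub>N(x)\<close>. The core of \<open>H\<close> depends only on the conjugacy
  class of \<open>H\<close>, so the first sum below is over the classes of subgroups with core \<open>N\<close>.
\<close>

definition core_coeffsum ::
  "('g, 'm) monoid_scheme \<Rightarrow> 'g set set \<Rightarrow> 'g set \<Rightarrow> 'g burnside \<Rightarrow> int" where
  "core_coeffsum G D N x =
     (\<Sum>C\<in>conj_class G ` {H \<in> D. subgroup_core G H = N}. burnside_coeff G D x C)"

definition upper_coeffsum ::
  "('g, 'm) monoid_scheme \<Rightarrow> 'g set set \<Rightarrow> 'g set \<Rightarrow> 'g burnside \<Rightarrow> int" where
  "upper_coeffsum G D N x =
     (\<Sum>M\<in>{M \<in> D. M \<lhd> G \<and> N \<subseteq> M}. core_coeffsum G D M x)"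

definition mark ::
  "('g, 'm) monoid_scheme \<Rightarrow> 'g set set \<Rightarrow> 'g set \<Rightarrow> 'g burnside \<Rightarrow> int" where
  "mark G D K =
     (\<lambda>A\<in>carrier (partial_burnside_ring G D).
        the_elem ((\<lambda>(X, Y). int (card (fixed_points X K)) - int (card (fixed_points Y K))) ` A))"

definition fixed_hom ::
  "('g, 'm) monoid_scheme \<Rightarrow> 'g set set \<Rightarrow> 'g set \<Rightarrow> 'g burnside \<Rightarrow> 'g set burnside" where
  "fixed_hom G D N =
     (\<lambda>A\<in>carrier (partial_burnside_ring G D).
        the_elem ((\<lambda>(X, Y). virtual_class (G Mod N) (fixed_gset G N X) (fixed_gset G N Y)) ` A))"

end

theory Submission
  imports Defs
begin

text \<open>
  Two finite \<open>G\<close>-sets with the same number of \<open>K\<close>-fixed points for every subgroup \<open>K\<close> are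
  isomorphic, so an element of the Burnside ring is determined by its marks, and every identity
  in the ring may be checked on marks. The marks of \<open>x\<^sup>N\<close> are those of \<open>x\<close> at the subgroups
  containing \<open>N\<close>. Hence \<open>[G/H]\<^sup>N\<close> is \<open>[(G/N)/(H/N)]\<close> if \<open>N \<le> H\<close> and \<open>0\<close> otherwise, so that the
  coefficients of \<open>x\<^sup>N\<close> are exactly those of \<open>x\<close> at the classes of subgroups above \<open>N\<close>; as \<open>N\<close> is
  normal, these are the subgroups with core above \<open>N\<close>. By Burnside's orbit counting, a coefficient
  sum is the average of the marks at cyclic subgroups. For a unit these marks are \<open>\<plusminus>1\<close>, and
  the average is an integer of absolute value at most one.
\<close>

section \<open>Finite group actions are determined by their marks\<close>

text \<open>The ring is presented through classes of pairs, collapsed by \<open>the_elem\<close> and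
  stabilised by an unspecified summand \<open>Z\<close>. Treating these by explicit isomorphisms
  would require one for every ring law and every change of representatives. The theorem that marks
  detect isomorphism removes this at once: a class becomes the set of pairs with a prescribed
  integer function on subgroups, \<open>Z\<close> cancels, and what remains to be checked are
  identities between integers. For coset spaces a single counting formula carries the load: the mark
  of G/H at K times |H| is the number of a for which K lies in the conjugate of H by a. It yields
  invariance under conjugation, triangularity of the table of marks, the orbit count, and the
  comparison of G/H with (G/N)/(H/N), where the two counts differ by the factor |N|.\<close>

definition acts_on :: "('g, 'm) monoid_scheme \<Rightarrow> 'x set \<Rightarrow> ('g \<Rightarrow> 'x \<Rightarrow> 'x) \<Rightarrow> bool" where
  "acts_on G E a \<longleftrightarrow>
     (\<forall>g\<in>carrier G. \<forall>x\<in>E. a g x \<in> E) \<and> (\<forall>x\<in>E. a \<one>\<^bsub>G\<^esub> x = x) \<and>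
     (\<forall>g\<in>carrier G. \<forall>h\<in>carrier G. \<forall>x\<in>E. a (g \<otimes>\<^bsub>G\<^esub> h) x = a g (a h x))"

lemma acts_on_mult:
  "\<lbrakk>acts_on G E a; g \<in> carrier G; h \<in> carrier G; x \<in> E\<rbrakk> \<Longrightarrow> a (g \<otimes>\<^bsub>G\<^esub> h) x = a g (a h x)"
  by (simp add: acts_on_def)

definition fixed_by :: "'x set \<Rightarrow> ('g \<Rightarrow> 'x \<Rightarrow> 'x) \<Rightarrow> 'g set \<Rightarrow> 'x set" where
  "fixed_by E a K = {x \<in> E. \<forall>g\<in>K. a g x = x}"

lemma finite_fixed_by [simp]: "finite E \<Longrightarrow> finite (fixed_by E a K)"
  by (simp add: fixed_by_def)

lemma card_fixed_by_iso:
  assumes "acts_on G E a" "K \<subseteq> carrier G" "bij_betw f E F"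
    and f: "\<And>g x. g \<in> carrier G \<Longrightarrow> x \<in> E \<Longrightarrow> f (a g x) = b g (f x)"
  shows "card (fixed_by E a K) = card (fixed_by F b K)"
proof -
  have "f x \<in> fixed_by F b K \<longleftrightarrow> x \<in> fixed_by E a K" if "x \<in> E" for x
  proof -
    have "b g (f x) = f x \<longleftrightarrow> a g x = x" if "g \<in> K" for g
    proof -
      have g: "g \<in> carrier G" using that assms(2) by auto
      then have "a g x \<in> E" using assms(1) \<open>x \<in> E\<close> by (auto simp: acts_on_def)
      then show ?thesis using f[OF g \<open>x \<in> E\<close>] assms(3) \<open>x \<in> E\<close>
        by (metis bij_betw_imp_inj_on inj_on_eq_iff)
    qed
    then show ?thesis using that assms(3) by (auto simp: fixed_by_def bij_betw_def)
  qed
  moreover have "\<exists>x\<in>E. y = f x" if "y \<in> F" for y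
    using that assms(3) by (auto simp: bij_betw_def)
  moreover have "fixed_by E a K \<subseteq> E" "fixed_by F b K \<subseteq> F" by (auto simp: fixed_by_def)
  ultimately have "f ` fixed_by E a K = fixed_by F b K"
    by blast
  then have "bij_betw f (fixed_by E a K) (fixed_by F b K)"
    by (rule bij_betw_subset[OF assms(3), rotated]) (auto simp: fixed_by_def)
  then show ?thesis by (rule bij_betw_same_card)
qed

text \<open>\<open>acts_on\<close> demands no extensionality, so the same \<open>a\<close> acts on
  an orbit and on its complement without being restricted anew.\<close>

lemma acts_on_subset:
  assumes "acts_on G E a" "F \<subseteq> E" "\<And>g x. g \<in> carrier G \<Longrightarrow> x \<in> F \<Longrightarrow> a g x \<in> F"
  shows "acts_on G F a"
  using assms unfolding acts_on_def by (meson subsetD)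

context group
begin

lemma acts_on_inv:
  assumes "acts_on G E a" "g \<in> carrier G" "x \<in> E"
  shows "a (inv g) (a g x) = x" "a g (a (inv g) x) = x"
proof -
  have "a (inv g \<otimes> g) x = a (inv g) (a g x)" "a (g \<otimes> inv g) x = a g (a (inv g) x)"
    using assms inv_closed[OF assms(2)] unfolding acts_on_def by blast+
  then show "a (inv g) (a g x) = x" "a g (a (inv g) x) = x"
    using assms by (simp_all add: acts_on_def)
qed

text \<open>The orbit map at \<open>x\<close> identifies group elements exactly along left cosets of
  the stabilizer; \<open>orbit_iso\<close> rests on this comparison.\<close>

lemma acts_on_eq_iff:
  assumes "acts_on G E a" "g \<in> carrier G" "h \<in> carrier G" "x \<in> E"
  shows "a g x = a h x \<longleftrightarrow> inv h \<otimes> g \<in> stabilizer G a x"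
proof -
  have *: "a (inv h \<otimes> g) x = a (inv h) (a g x)" "a g x \<in> E"
    using assms unfolding acts_on_def by auto
  show ?thesis
    using acts_on_inv[OF assms(1,3)] * assms by (auto simp: stabilizer_def) metis
qed

lemma acts_on_bij:
  assumes "acts_on G E a" "g \<in> carrier G"
  shows "bij_betw (a g) E E"
  by (rule bij_betw_byWitness[where f' = "a (inv g)"])
    (use assms acts_on_inv[OF assms] in \<open>auto simp: acts_on_def\<close>)

lemma subgroup_stabilizer:
  assumes "acts_on G E a" "x \<in> E"
  shows "subgroup (stabilizer G a x) G"
proof (rule subgroupI)
  fix g assume g: "g \<in> stabilizer G a x"
  then show "inv g \<in> stabilizer G a x"
    using acts_on_inv(1)[OF assms(1) _ assms(2), of g] by (auto simp: stabilizer_def)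
qed (use assms in \<open>auto simp: stabilizer_def acts_on_def intro: exI[of _ \<one>]\<close>)

lemma acts_on_orbit:
  assumes "acts_on G E a" "x \<in> E"
  shows "orbit G a x \<subseteq> E" "acts_on G (orbit G a x) a" "acts_on G (E - orbit G a x) a" "x \<in> orbit G a x"
proof -
  show 1: "orbit G a x \<subseteq> E" using assms by (auto simp: orbit_def acts_on_def)
  have 2: "a g y \<in> orbit G a x" if gy: "g \<in> carrier G" "y \<in> orbit G a x" for g y
    proof -
    obtain h where h: "h \<in> carrier G" "y = a h x" using gy by (auto simp: orbit_def)
    then have "a g y = a (g \<otimes> h) x" using assms gy by (auto simp: acts_on_def)
    then show ?thesis using h gy by (auto simp: orbit_def)
  qed
  show "acts_on G (orbit G a x) a" using acts_on_subset[OF assms(1) 1] 2 by blast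
  have "a g y \<notin> orbit G a x" if "g \<in> carrier G" "y \<in> E" "y \<notin> orbit G a x" for g y
    using 2[of "inv g" "a g y"] acts_on_inv[OF assms(1)] that by auto
  then show "acts_on G (E - orbit G a x) a"
    using assms(1) by (intro acts_on_subset[OF assms(1)]) (auto simp: acts_on_def)
  show "x \<in> orbit G a x" using assms by (force simp: orbit_def acts_on_def)
qed

lemma orbit_iso:
  assumes a: "acts_on G E a" "x \<in> E" and b: "acts_on G F b" "y \<in> F"
    and st: "stabilizer G a x = stabilizer G b y"
  obtains f where "bij_betw f (orbit G a x) (orbit G b y)"
    "\<And>g z. g \<in> carrier G \<Longrightarrow> z \<in> orbit G a x \<Longrightarrow> f (a g z) = b g (f z)"
proof -
  \<comment> \<open>A point of the orbit is \<open>a g x\<close> for some \<open>g\<close> and is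
    sent to \<open>b g y\<close>. Equal stabilizers make the choice of \<open>g\<close> irrelevant
    and the map injective.\<close>
  define f where "f z = b (SOME g. g \<in> carrier G \<and> a g x = z) y" for z
  have eq: "a g x = a h x \<longleftrightarrow> b g y = b h y" if "g \<in> carrier G" "h \<in> carrier G" for g h
    using acts_on_eq_iff[OF a(1) that a(2)] acts_on_eq_iff[OF b(1) that b(2)] st by simp
  have f: "f (a g x) = b g y" if "g \<in> carrier G" for g
    using someI[of "\<lambda>h. h \<in> carrier G \<and> a h x = a g x" g] that eq unfolding f_def by metis
  have "bij_betw f (orbit G a x) (orbit G b y)"
    unfolding bij_betw_def inj_on_def using f eq by (auto simp: orbit_def image_def)
  moreover have "f (a g z) = b g (f z)" if g: "g \<in> carrier G" and z: "z \<in> orbit G a x" for g z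
  proof -
    obtain h where h: "h \<in> carrier G" "z = a h x" using z by (auto simp: orbit_def)
    then have "a g z = a (g \<otimes> h) x" "b g (b h y) = b (g \<otimes> h) y"
      using a b g unfolding acts_on_def by auto
    then show ?thesis using f g h by auto
  qed
  ultimately show thesis using that by blast
qed

text \<open>
  Choose \<open>x\<close> with a stabilizer of maximal order. As that stabilizer has a fixed point in
  both sets, the two sets contain isomorphic orbits, and these can be removed.
\<close>

theorem equal_marks_imp_iso:
  assumes "finite E" "finite F" "acts_on G E a" "acts_on G F b" "finite (carrier G)"
    and "\<And>K. subgroup K G \<Longrightarrow> card (fixed_by E a K) = card (fixed_by F b K)"
  shows "\<exists>f. bij_betw f E F \<and> (\<forall>g\<in>carrier G. \<forall>x\<in>E. f (a g x) = b g (f x))"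
  using assms
proof (induction "card E" arbitrary: E F rule: less_induct)
  case less
  note E = less.prems(1,3) and F = less.prems(2,4) and m = less.prems(6)
  show ?case
  proof (cases "E = {}")
    case True
    \<comment> \<open>The mark at the trivial subgroup is the number of points, so \<open>F\<close>
      is empty as well.\<close>
    have "fixed_by F b {\<one>} = F" using F by (auto simp: fixed_by_def acts_on_def)
    then have "card F = 0" using m[of "{\<one>}"] True triv_subgroup by (simp add: fixed_by_def)
    then show ?thesis using True F by (auto simp: bij_betw_def)
  next
    case False
    let ?c = "\<lambda>z. card (stabilizer G a z)"
    have "Max (?c ` E) \<in> ?c ` E" using E(1) False by simp
    then obtain x where x: "x \<in> E" "Max (?c ` E) = ?c x" by auto
    with E(1) have x_max: "?c z \<le> ?c x" if "z \<in> E" for z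
      using that by (metis Max_ge finite_imageI imageI)
    let ?S = "stabilizer G a x"
    have fs: "finite (stabilizer G a z)" for z using less.prems(5) by (auto simp: stabilizer_def)
    have "x \<in> fixed_by E a ?S" using x by (auto simp: fixed_by_def stabilizer_def)
    then have "fixed_by F b ?S \<noteq> {}"
      using m[OF subgroup_stabilizer[OF E(2) x(1)]] E(1) by force
    then obtain y where y: "y \<in> F" "\<forall>g\<in>?S. b g y = y" by (auto simp: fixed_by_def)
    have s1: "?S \<subseteq> stabilizer G b y" using y by (auto simp: stabilizer_def)
    \<comment> \<open>Going back from \<open>F\<close> to \<open>E\<close> squeezes the stabilizer
      of \<open>y\<close> between those of \<open>x\<close> and \<open>z\<close>; maximality at
      \<open>x\<close> forces equality.\<close>
    have "y \<in> fixed_by F b (stabilizer G b y)" using y by (auto simp: fixed_by_def stabilizer_def)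
    then have "fixed_by E a (stabilizer G b y) \<noteq> {}"
      using m[OF subgroup_stabilizer[OF F(2) y(1)]] F(1) by force
    then obtain z where z: "z \<in> E" "\<forall>g\<in>stabilizer G b y. a g z = z" by (auto simp: fixed_by_def)
    have s2: "stabilizer G b y \<subseteq> stabilizer G a z" using z by (auto simp: stabilizer_def)
    have "?S = stabilizer G a z" using card_seteq[OF fs, of ?S z] s1 s2 x_max[OF z(1)] by auto
    with s1 s2 have st: "?S = stabilizer G b y" by auto
    let ?A = "orbit G a x" and ?B = "orbit G b y"
    note oa = acts_on_orbit[OF E(2) x(1)] and ob = acts_on_orbit[OF F(2) y(1)]
    obtain f where f: "bij_betw f ?A ?B" "\<And>g z. g \<in> carrier G \<Longrightarrow> z \<in> ?A \<Longrightarrow> f (a g z) = b g (f z)"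
      using orbit_iso[OF E(2) x(1) F(2) y(1) st] by blast
    \<comment> \<open>Removing isomorphic orbits subtracts equal marks, so the hypothesis passes to
      the complements.\<close>
    have "card (fixed_by (E - ?A) a K) = card (fixed_by (F - ?B) b K)" if K: "subgroup K G" for K
    proof -
      have KG: "K \<subseteq> carrier G" using K subgroup.subset by blast
      have 1: "card (fixed_by ?A a K) = card (fixed_by ?B b K)"
        by (rule card_fixed_by_iso[OF oa(2) KG f(1)]) (rule f(2))
      have "fixed_by (E - ?A) a K = fixed_by E a K - fixed_by ?A a K"
        "fixed_by (F - ?B) b K = fixed_by F b K - fixed_by ?B b K"
        "fixed_by ?A a K \<subseteq> fixed_by E a K" "fixed_by ?B b K \<subseteq> fixed_by F b K"
        using oa(1) ob(1) by (auto simp: fixed_by_def)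
      then show ?thesis using 1 m[OF K] E(1) F(1)
        by (simp add: card_Diff_subset finite_subset[OF oa(1)] finite_subset[OF ob(1)])
    qed
    moreover have "card (E - ?A) < card E" using oa x(1) E(1) by (intro psubset_card_mono) auto
    ultimately obtain h where h: "bij_betw h (E - ?A) (F - ?B)"
      "\<And>g z. g \<in> carrier G \<Longrightarrow> z \<in> E - ?A \<Longrightarrow> h (a g z) = b g (h z)"
      using less.hyps[of "E - ?A" "F - ?B"] oa(3) ob(3) E(1) F(1) less.prems(5) by auto
    let ?f = "\<lambda>z. if z \<in> ?A then f z else h z"
    have "bij_betw ?f (?A \<union> (E - ?A)) (?B \<union> (F - ?B))"
      by (rule bij_betw_disjoint_Un) (use f h in auto)
    then have "bij_betw ?f E F" using oa(1) ob(1) by (simp add: Un_absorb1)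
    moreover have "?f (a g z) = b g (?f z)" if "g \<in> carrier G" "z \<in> E" for g z
      using that f(2) h(2) oa(2,3) by (auto simp: acts_on_def)
    ultimately show ?thesis by blast
  qed
qed

end

section \<open>The ghost coordinates of the Burnside ring\<close>

lemma fixed_points_eq: "fixed_points X K = fixed_by (points X) (action X) K"
  by (simp add: fixed_points_def fixed_by_def)

definition num_fixed :: "('g, 'x) gset \<Rightarrow> 'g set \<Rightarrow> int" where
  "num_fixed X K = int (card (fixed_points X K))"

lemma finite_gsetD:
  assumes "finite_gset G X"
  shows "finite (points X)" "acts_on G (points X) (action X)"
    "\<And>g. g \<in> carrier G \<Longrightarrow> action X g \<in> extensional (points X)"
proof -
  interpret group_action G "points X" "action X" using assms by (simp add: finite_gset_def)
  show "finite (points X)" using assms by (simp add: finite_gset_def)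
  show "acts_on G (points X) (action X)"
    using element_image id_eq_one composition_rule unfolding acts_on_def by (metis restrict_apply')
  show "action X g \<in> extensional (points X)" if "g \<in> carrier G" for g
    using bij_prop0[OF that] by (simp add: Bij_def)
qed

context group
begin

lemma finite_gsetI:
  assumes "finite (points X)" "acts_on G (points X) (action X)"
    "\<And>g. g \<in> carrier G \<Longrightarrow> action X g \<in> extensional (points X)"
  shows "finite_gset G X"
proof -
  have Bij: "action X g \<in> Bij (points X)" if "g \<in> carrier G" for g
    using assms(3)[OF that] acts_on_bij[OF assms(2) that] by (simp add: Bij_def)
  have "action X (g \<otimes> h) = compose (points X) (action X g) (action X h)"
    if "g \<in> carrier G" "h \<in> carrier G" for g h
  proof (rule extensionalityI[of _ "points X"])
    show "action X (g \<otimes> h) x = compose (points X) (action X g) (action X h) x" if "x \<in> points X" for x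
      using that \<open>g \<in> carrier G\<close> \<open>h \<in> carrier G\<close> assms(2) by (simp add: compose_def acts_on_def)
  qed (use assms(3) that in auto)
  then have "action X \<in> hom G (BijGroup (points X))"
    using Bij by (simp add: hom_def BijGroup_def)
  then have "group_action G (points X) (action X)"
    by (simp add: group_action_def group_hom_def group_hom_axioms_def is_group group_BijGroup)
  then show ?thesis using assms(1) by (simp add: finite_gset_def)
qed

lemma finite_gset_empty: "finite_gset G gset_empty"
  by (rule finite_gsetI) (auto simp: gset_empty_def acts_on_def)

lemma finite_gset_sum:
  assumes "finite_gset G X" "finite_gset G Y"
  shows "finite_gset G (gset_sum X Y)"
  using finite_gsetD[OF assms(1)] finite_gsetD[OF assms(2)]
  by (intro finite_gsetI) (auto simp: gset_sum_def acts_on_def)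

lemma finite_gset_prod:
  assumes "finite_gset G X" "finite_gset G Y"
  shows "finite_gset G (gset_prod X Y)"
  using finite_gsetD[OF assms(1)] finite_gsetD[OF assms(2)]
  by (intro finite_gsetI) (auto simp: gset_prod_def acts_on_def)

end

lemma num_fixed_empty [simp]: "num_fixed gset_empty K = 0"
  by (simp add: num_fixed_def fixed_points_def gset_empty_def)

lemma (in group) num_fixed_sum:
  assumes "finite_gset G X" "finite_gset G Y"
  shows "num_fixed (gset_sum X Y) K = num_fixed X K + num_fixed Y K"
proof -
  have "fixed_points (gset_sum X Y) K = fixed_points X K <+> fixed_points Y K"
    by (auto simp: fixed_points_def gset_sum_def)
  then show ?thesis
    using finite_gsetD(1)[OF assms(1)] finite_gsetD(1)[OF assms(2)]
    by (simp add: num_fixed_def card_Plus fixed_points_def)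
qed

lemma num_fixed_prod: "num_fixed (gset_prod X Y) K = num_fixed X K * num_fixed Y K"
proof -
  have "fixed_points (gset_prod X Y) K = fixed_points X K \<times> fixed_points Y K"
    by (auto simp: fixed_points_def gset_prod_def)
  then show ?thesis by (simp add: num_fixed_def card_cartesian_product)
qed

lemma num_fixed_iso:
  assumes "finite_gset G X" "gset_iso G X Y" "K \<subseteq> carrier G"
  shows "num_fixed X K = num_fixed Y K"
proof -
  obtain f where f: "bij_betw f (points X) (points Y)"
    "\<And>g x. g \<in> carrier G \<Longrightarrow> x \<in> points X \<Longrightarrow> f (action X g x) = action Y g (f x)"
    using assms(2) by (auto simp: gset_iso_def)
  have "card (fixed_by (points X) (action X) K) = card (fixed_by (points Y) (action Y) K)"
    by (rule card_fixed_by_iso[OF finite_gsetD(2)[OF assms(1)] assms(3) f(1)]) (rule f(2))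
  then show ?thesis by (simp add: num_fixed_def fixed_points_eq)
qed

section \<open>Virtual classes in terms of marks\<close>

locale finite_group = group +
  assumes finite_carrier: "finite (carrier G)"
begin

lemma gset_iso_iff:
  assumes "finite_gset G X" "finite_gset G Y"
  shows "gset_iso G X Y \<longleftrightarrow> (\<forall>K. subgroup K G \<longrightarrow> num_fixed X K = num_fixed Y K)"
proof
  show "gset_iso G X Y \<Longrightarrow> \<forall>K. subgroup K G \<longrightarrow> num_fixed X K = num_fixed Y K"
    using num_fixed_iso[OF assms(1)] subgroup.subset by blast
next
  assume "\<forall>K. subgroup K G \<longrightarrow> num_fixed X K = num_fixed Y K"
  then show "gset_iso G X Y" unfolding gset_iso_def
    by (intro equal_marks_imp_iso finite_gsetD[OF assms(1)] finite_gsetD[OF assms(2)] finite_carrier)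
      (simp_all add: num_fixed_def fixed_points_eq)
qed

text \<open>Marks are additive with integer values, so the summand \<open>Z\<close> cancels;
  conversely the empty set can serve as \<open>Z\<close>. The points of \<open>X\<close> and
  \<open>Y\<close> may have any types, only the members of the class are modelled on natural
  numbers.\<close>

lemma virtual_class_eq:
  assumes "finite_gset G X" "finite_gset G Y"
  shows "virtual_class G X Y = {(X', Y'). finite_gset G X' \<and> finite_gset G Y' \<and>
    (\<forall>K. subgroup K G \<longrightarrow> num_fixed X K - num_fixed Y K = num_fixed X' K - num_fixed Y' K)}"
proof -
  have "(\<exists>Z :: ('a, nat) gset. finite_gset G Z \<and>
           gset_iso G (gset_sum (gset_sum X Y') Z) (gset_sum (gset_sum X' Y) Z)) \<longleftrightarrow>
     (\<forall>K. subgroup K G \<longrightarrow> num_fixed X K - num_fixed Y K = num_fixed X' K - num_fixed Y' K)"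
    if "finite_gset G X'" "finite_gset G Y'" for X' Y' :: "('a, nat) gset"
  proof -
    have "gset_iso G (gset_sum (gset_sum X Y') Z) (gset_sum (gset_sum X' Y) Z) \<longleftrightarrow>
      (\<forall>K. subgroup K G \<longrightarrow> num_fixed X K - num_fixed Y K = num_fixed X' K - num_fixed Y' K)"
      if Z: "finite_gset G Z" for Z :: "('a, nat) gset"
    proof -
      note fin = assms \<open>finite_gset G X'\<close> \<open>finite_gset G Y'\<close> Z
      have "num_fixed (gset_sum (gset_sum X Y') Z) K = num_fixed X K + num_fixed Y' K + num_fixed Z K"
        "num_fixed (gset_sum (gset_sum X' Y) Z) K = num_fixed X' K + num_fixed Y K + num_fixed Z K" for K
        by (simp_all add: num_fixed_sum finite_gset_sum fin)
      moreover have "finite_gset G (gset_sum (gset_sum X Y') Z)" "finite_gset G (gset_sum (gset_sum X' Y) Z)"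
        by (simp_all add: finite_gset_sum fin)
      ultimately show ?thesis by (simp add: gset_iso_iff algebra_simps)
    qed
    then show ?thesis using finite_gset_empty by blast
  qed
  then show ?thesis unfolding virtual_class_def by blast
qed

end

text \<open>Each well-definedness claim implicit in a \<open>the_elem\<close> of the definitions is
  discharged through this rule.\<close>

lemma the_elem_image_const:
  assumes "A \<noteq> {}" "\<And>x. x \<in> A \<Longrightarrow> f x = c"
  shows "the_elem (f ` A) = c"
proof -
  have "f ` A = {c}" using assms by auto
  then show ?thesis by simp
qed

text \<open>The mark on the whole Burnside ring, without the restriction to a partial ring built
  into \<open>mark\<close>; hence one function serves every family of subgroups.\<close>

definition ghost :: "'g set \<Rightarrow> 'g burnside \<Rightarrow> int" where
  "ghost K A = the_elem ((\<lambda>(X, Y). num_fixed X K - num_fixed Y K) ` A)"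

lemma mark_eq_ghost:
  "A \<in> carrier (partial_burnside_ring G D) \<Longrightarrow> mark G D K A = ghost K A"
  by (simp add: mark_def ghost_def num_fixed_def)

text \<open>Coset spaces, sums and products have points of other types, whereas the carrier of
  \<open>burnside_ring\<close> is built from sets of natural numbers. The action is transported
  along an enumeration of the points.\<close>

lemma (in group) nat_model:
  assumes "finite_gset G X"
  obtains X' :: "('a, nat) gset" where "finite_gset G X'" "gset_iso G X X'"
proof -
  let ?n = "card (points X)"
  note X = finite_gsetD[OF assms]
  obtain f where f: "bij_betw f (points X) {0..<?n}" using ex_bij_betw_finite_nat[OF X(1)] by blast
  define f' where "f' = inv_into (points X) f"
  have f': "f' i \<in> points X" "f (f' i) = i" if "i < ?n" for i
    using that f bij_betw_inv_into_right[OF f, of i] inv_into_into[of i f "points X"]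
    by (auto simp: f'_def bij_betw_def)
  have f'f: "f' (f x) = x" "f x < ?n" if "x \<in> points X" for x
    using that f bij_betw_inv_into_left[OF f] by (auto simp: f'_def bij_betw_def)
  define X' where "X' = \<lparr>points = {0..<?n}, action = (\<lambda>g. \<lambda>i\<in>{0..<?n}. f (action X g (f' i)))\<rparr>"
  have "finite_gset G X'"
    using X(2) by (intro finite_gsetI) (auto simp: X'_def acts_on_def f' f'f)
  moreover have "gset_iso G X X'"
    unfolding gset_iso_def using f by (intro exI[of _ f]) (auto simp: X'_def f'f)
  ultimately show thesis using that by blast
qed

context finite_group
begin

lemma virtual_class_closed:
  assumes "finite_gset G X" "finite_gset G Y"
  shows "virtual_class G X Y \<in> carrier (burnside_ring G)"
proof -
  obtain X' :: "('a, nat) gset" where X': "finite_gset G X'" "gset_iso G X X'"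
    using nat_model[OF assms(1)] .
  obtain Y' :: "('a, nat) gset" where Y': "finite_gset G Y'" "gset_iso G Y Y'"
    using nat_model[OF assms(2)] .
  have "num_fixed X K = num_fixed X' K" "num_fixed Y K = num_fixed Y' K" if "subgroup K G" for K
    using num_fixed_iso[OF assms(1) X'(2) subgroup.subset[OF that]]
      num_fixed_iso[OF assms(2) Y'(2) subgroup.subset[OF that]] by simp_all
  then have "virtual_class G X Y = virtual_class G X' Y'"
    by (auto simp: virtual_class_eq assms X' Y')
  then show ?thesis using X'(1) Y'(1) by (auto simp: burnside_ring_def)
qed

text \<open>A class is the full set of pairs with given marks, so any member computes
  \<open>ghost\<close> and generates the class again.\<close>

lemma burnside_repr:
  assumes "A \<in> carrier (burnside_ring G)"
  shows "A \<noteq> {}"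
    and "(X, Y) \<in> A \<Longrightarrow> finite_gset G X" "(X, Y) \<in> A \<Longrightarrow> finite_gset G Y"
    and "\<lbrakk>(X, Y) \<in> A; subgroup K G\<rbrakk> \<Longrightarrow> num_fixed X K - num_fixed Y K = ghost K A"
    and "(X, Y) \<in> A \<Longrightarrow> virtual_class G X Y = A"
proof -
  obtain X0 Y0 :: "('a, nat) gset"
    where *: "finite_gset G X0" "finite_gset G Y0" "A = virtual_class G X0 Y0"
    using assms by (auto simp: burnside_ring_def)
  then have A: "A = {(X', Y'). finite_gset G X' \<and> finite_gset G Y' \<and>
    (\<forall>K. subgroup K G \<longrightarrow> num_fixed X0 K - num_fixed Y0 K = num_fixed X' K - num_fixed Y' K)}"
    by (simp add: virtual_class_eq)
  then have "(X0, Y0) \<in> A" using * by simp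
  then show "A \<noteq> {}" by blast
  have mem: "finite_gset G U" "finite_gset G V"
      "\<And>K. subgroup K G \<Longrightarrow> num_fixed U K - num_fixed V K = num_fixed X0 K - num_fixed Y0 K"
    if "(U, V) \<in> A" for U V
    using that unfolding A by simp_all
  have g: "ghost K A = num_fixed X0 K - num_fixed Y0 K" if "subgroup K G" for K
    unfolding ghost_def by (rule the_elem_image_const) (use \<open>A \<noteq> {}\<close> mem(3)[OF _ that] in auto)
  show "\<lbrakk>(X, Y) \<in> A; subgroup K G\<rbrakk> \<Longrightarrow> num_fixed X K - num_fixed Y K = ghost K A"
    using mem(3) g by simp
  show "(X, Y) \<in> A \<Longrightarrow> finite_gset G X" "(X, Y) \<in> A \<Longrightarrow> finite_gset G Y"
    using mem by blast+
  show "virtual_class G X Y = A" if "(X, Y) \<in> A"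
    by (simp add: virtual_class_eq[OF mem(1,2)[OF that]] A mem(3)[OF that])
qed

lemma ghost_virtual_class:
  assumes "finite_gset G X" "finite_gset G Y" "subgroup K G"
  shows "ghost K (virtual_class G X Y) = num_fixed X K - num_fixed Y K"
proof -
  note A = burnside_repr[OF virtual_class_closed[OF assms(1,2)]]
  obtain X' Y' where "(X', Y') \<in> virtual_class G X Y" using A(1) by auto
  then show ?thesis
    using A(4)[of X' Y' K] assms by (simp add: virtual_class_eq)
qed

lemma burnside_eqI:
  assumes "A \<in> carrier (burnside_ring G)" "B \<in> carrier (burnside_ring G)"
    and eq: "\<And>K. subgroup K G \<Longrightarrow> ghost K A = ghost K B"
  shows "A = B"
proof -
  obtain X Y where XY: "(X, Y) \<in> A" using burnside_repr(1)[OF assms(1)] by auto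
  obtain X' Y' where XY': "(X', Y') \<in> B" using burnside_repr(1)[OF assms(2)] by auto
  note A = burnside_repr(2-)[OF assms(1) XY] and B = burnside_repr(2-)[OF assms(2) XY']
  have "virtual_class G X Y = virtual_class G X' Y'"
    by (simp add: virtual_class_eq A(1-3) B(1-3) eq)
  then show ?thesis using A(4) B(4) by metis
qed

lemma burnside_zero:
  shows "\<zero>\<^bsub>burnside_ring G\<^esub> \<in> carrier (burnside_ring G)"
    and "subgroup K G \<Longrightarrow> ghost K \<zero>\<^bsub>burnside_ring G\<^esub> = 0"
proof -
  have z: "\<zero>\<^bsub>burnside_ring G\<^esub> = virtual_class G (gset_empty :: ('a, nat) gset) (gset_empty :: ('a, nat) gset)"
    by (simp add: burnside_ring_def gset_class_def)
  show "\<zero>\<^bsub>burnside_ring G\<^esub> \<in> carrier (burnside_ring G)"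
    unfolding z by (intro virtual_class_closed finite_gset_empty)
  show "subgroup K G \<Longrightarrow> ghost K \<zero>\<^bsub>burnside_ring G\<^esub> = 0"
    unfolding z by (simp add: ghost_virtual_class finite_gset_empty)
qed

lemma burnside_add:
  assumes "A \<in> carrier (burnside_ring G)" "B \<in> carrier (burnside_ring G)"
  shows "A \<oplus>\<^bsub>burnside_ring G\<^esub> B \<in> carrier (burnside_ring G)"
    and "subgroup K G \<Longrightarrow> ghost K (A \<oplus>\<^bsub>burnside_ring G\<^esub> B) = ghost K A + ghost K B"
proof -
  note reprA = burnside_repr[OF assms(1)] and reprB = burnside_repr[OF assms(2)]
  let ?f = "\<lambda>((X, Y), (X', Y')). virtual_class G (gset_sum X X') (gset_sum Y Y')"
  have f: "?f ((X, Y), (X', Y')) \<in> carrier (burnside_ring G)"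
    "subgroup K G \<Longrightarrow> ghost K (?f ((X, Y), (X', Y'))) = ghost K A + ghost K B"
    if "(X, Y) \<in> A" "(X', Y') \<in> B" for X Y X' Y' K
  proof -
    note A = reprA(2-)[OF that(1)] and B = reprB(2-)[OF that(2)]
    show "?f ((X, Y), (X', Y')) \<in> carrier (burnside_ring G)"
      by (simp add: virtual_class_closed finite_gset_sum A B)
    show "ghost K (?f ((X, Y), (X', Y'))) = ghost K A + ghost K B" if "subgroup K G"
      using A(3)[OF that] B(3)[OF that]
      by (simp add: ghost_virtual_class finite_gset_sum num_fixed_sum A(1,2) B(1,2) that)
  qed
  obtain X Y X' Y' where r: "(X, Y) \<in> A" "(X', Y') \<in> B" using reprA(1) reprB(1) by auto
  have "A \<oplus>\<^bsub>burnside_ring G\<^esub> B = the_elem (?f ` (A \<times> B))"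
    by (simp add: burnside_ring_def)
  also have "\<dots> = ?f ((X, Y), (X', Y'))"
  proof (rule the_elem_image_const)
    fix p assume "p \<in> A \<times> B"
    then obtain U V U' V' where p: "p = ((U, V), (U', V'))" "(U, V) \<in> A" "(U', V') \<in> B"
      by (metis SigmaE surj_pair)
    \<comment> \<open>Independence of the representatives: both classes have as marks the sums of
      those of \<open>A\<close> and \<open>B\<close>.\<close>
    show "?f p = ?f ((X, Y), (X', Y'))"
      unfolding p(1) using f[OF p(2,3)] f[OF r] by (intro burnside_eqI) simp_all
  qed (use r in auto)
  finally show "A \<oplus>\<^bsub>burnside_ring G\<^esub> B \<in> carrier (burnside_ring G)"
    "subgroup K G \<Longrightarrow> ghost K (A \<oplus>\<^bsub>burnside_ring G\<^esub> B) = ghost K A + ghost K B"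
    using f[OF r] by simp_all
qed

lemma burnside_mult:
  assumes "A \<in> carrier (burnside_ring G)" "B \<in> carrier (burnside_ring G)" "subgroup K G"
  shows "ghost K (A \<otimes>\<^bsub>burnside_ring G\<^esub> B) = ghost K A * ghost K B"
proof -
  note reprA = burnside_repr[OF assms(1)] and reprB = burnside_repr[OF assms(2)]
  let ?f = "\<lambda>((X, Y), (X', Y')). virtual_class G (gset_sum (gset_prod X X') (gset_prod Y Y'))
                         (gset_sum (gset_prod X Y') (gset_prod Y X'))"
  have f: "?f ((X, Y), (X', Y')) \<in> carrier (burnside_ring G)"
    "subgroup K G \<Longrightarrow> ghost K (?f ((X, Y), (X', Y'))) = ghost K A * ghost K B"
    if "(X, Y) \<in> A" "(X', Y') \<in> B" for X Y X' Y' K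
  proof -
    note A = reprA(2-)[OF that(1)] and B = reprB(2-)[OF that(2)]
    show "?f ((X, Y), (X', Y')) \<in> carrier (burnside_ring G)"
      by (simp add: virtual_class_closed finite_gset_sum finite_gset_prod A B)
    show "ghost K (?f ((X, Y), (X', Y'))) = ghost K A * ghost K B" if "subgroup K G"
      \<comment> \<open>With each \<open>ghost\<close> written as a difference of counts, the claim
        is the expansion of a product of two differences.\<close>
      unfolding A(3)[OF that, symmetric] B(3)[OF that, symmetric]
      by (simp add: ghost_virtual_class finite_gset_sum finite_gset_prod num_fixed_sum
          num_fixed_prod A(1,2) B(1,2) that algebra_simps)
  qed
  obtain X Y X' Y' where r: "(X, Y) \<in> A" "(X', Y') \<in> B" using reprA(1) reprB(1) by auto
  have "A \<otimes>\<^bsub>burnside_ring G\<^esub> B = the_elem (?f ` (A \<times> B))"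
    by (simp add: burnside_ring_def)
  also have "\<dots> = ?f ((X, Y), (X', Y'))"
  proof (rule the_elem_image_const)
    fix p assume "p \<in> A \<times> B"
    then obtain U V U' V' where p: "p = ((U, V), (U', V'))" "(U, V) \<in> A" "(U', V') \<in> B"
      by (metis SigmaE surj_pair)
    show "?f p = ?f ((X, Y), (X', Y'))"
      unfolding p(1) using f[OF p(2,3)] f[OF r] by (intro burnside_eqI) simp_all
  qed (use r in auto)
  finally show ?thesis using f(2)[OF r assms(3)] by simp
qed

text \<open>Gives meaning to the finite sums and integer multiples in \<open>burnside_comb\<close>.
  The axioms hold mark by mark; the negative of [X] - [Y] is [Y] - [X].\<close>

sublocale burnside: abelian_group "burnside_ring G"
proof (rule abelian_groupI)
  fix A assume A: "A \<in> carrier (burnside_ring G)"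
  then obtain X Y where XY: "(X, Y) \<in> A" using burnside_repr(1)[OF A] by auto
  note r = burnside_repr(2-)[OF A XY]
  let ?B = "virtual_class G Y X"
  have B: "?B \<in> carrier (burnside_ring G)" using r by (simp add: virtual_class_closed)
  have "?B \<oplus>\<^bsub>burnside_ring G\<^esub> A = \<zero>\<^bsub>burnside_ring G\<^esub>"
    by (intro burnside_eqI burnside_add burnside_zero A B)
      (simp add: burnside_add burnside_zero A B ghost_virtual_class r(1,2) r(3)[symmetric])
  then show "\<exists>B\<in>carrier (burnside_ring G). B \<oplus>\<^bsub>burnside_ring G\<^esub> A = \<zero>\<^bsub>burnside_ring G\<^esub>"
    using B by blast
next
  fix A B C
  assume A: "A \<in> carrier (burnside_ring G)" and B: "B \<in> carrier (burnside_ring G)"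
    and C: "C \<in> carrier (burnside_ring G)"
  show "A \<oplus>\<^bsub>burnside_ring G\<^esub> B \<oplus>\<^bsub>burnside_ring G\<^esub> C = A \<oplus>\<^bsub>burnside_ring G\<^esub> (B \<oplus>\<^bsub>burnside_ring G\<^esub> C)"
    by (rule burnside_eqI) (simp_all add: burnside_add A B C)
next
  fix A B assume A: "A \<in> carrier (burnside_ring G)" and B: "B \<in> carrier (burnside_ring G)"
  show "A \<oplus>\<^bsub>burnside_ring G\<^esub> B = B \<oplus>\<^bsub>burnside_ring G\<^esub> A"
    by (rule burnside_eqI) (simp_all add: burnside_add A B)
next
  fix A assume A: "A \<in> carrier (burnside_ring G)"
  show "\<zero>\<^bsub>burnside_ring G\<^esub> \<oplus>\<^bsub>burnside_ring G\<^esub> A = A"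
    by (rule burnside_eqI) (simp_all add: burnside_add burnside_zero A)
qed (simp_all add: burnside_add burnside_zero)

section \<open>Linearity of marks\<close>

lemma ghost_neg:
  assumes "A \<in> carrier (burnside_ring G)" "subgroup K G"
  shows "ghost K (\<ominus>\<^bsub>burnside_ring G\<^esub> A) = - ghost K A"
  using burnside_add(2)[OF burnside.a_inv_closed[OF assms(1)] assms(1,2)]
  by (simp add: burnside.l_neg assms burnside_zero)

lemma ghost_nat_smult:
  fixes n :: nat
  assumes "A \<in> carrier (burnside_ring G)" "subgroup K G"
  shows "ghost K ([n] \<cdot>\<^bsub>burnside_ring G\<^esub> A) = int n * ghost K A"
  by (induction n) (simp_all add: assms burnside_zero burnside_add algebra_simps)

lemma ghost_int_smult:
  fixes n :: int
  assumes "A \<in> carrier (burnside_ring G)" "subgroup K G"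
  shows "ghost K ([n] \<cdot>\<^bsub>burnside_ring G\<^esub> A) = n * ghost K A"
  by (cases "n \<ge> 0") (simp_all add: add_pow_int_ge add_pow_int_lt ghost_nat_smult ghost_neg assms)

lemma ghost_finsum:
  assumes "finite I" "\<And>i. i \<in> I \<Longrightarrow> f i \<in> carrier (burnside_ring G)" "subgroup K G"
  shows "ghost K (\<Oplus>\<^bsub>burnside_ring G\<^esub>i\<in>I. f i) = (\<Sum>i\<in>I. ghost K (f i))"
  using assms by (induction I rule: finite_induct) (auto simp: burnside_zero burnside_add Pi_def)

end

section \<open>Marks of coset spaces and the basis of a partial Burnside ring\<close>

context group
begin

lemma inv_mult_cancel:
  assumes "g \<in> carrier G" "h \<in> carrier G"
  shows "inv g \<otimes> (g \<otimes> h) = h" "g \<otimes> (inv g \<otimes> h) = h"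
  using assms by (simp_all flip: m_assoc)

lemma conj_subgroup_eq:
  "conj_subgroup G g H = (\<lambda>h. g \<otimes> h \<otimes> inv g) ` H"
  by (auto simp: conj_subgroup_def l_coset_def r_coset_def)

lemma mem_conj_subgroup_iff:
  assumes "H \<subseteq> carrier G" "g \<in> carrier G" "x \<in> carrier G"
  shows "x \<in> conj_subgroup G g H \<longleftrightarrow> inv g \<otimes> x \<otimes> g \<in> H"
proof
  assume "x \<in> conj_subgroup G g H"
  then obtain h where h: "h \<in> H" "x = g \<otimes> h \<otimes> inv g" by (auto simp: conj_subgroup_eq)
  then have "inv g \<otimes> x \<otimes> g = h"
    using assms by (simp add: subset_iff m_assoc inv_mult_cancel)
  then show "inv g \<otimes> x \<otimes> g \<in> H" using h by simp
next
  assume *: "inv g \<otimes> x \<otimes> g \<in> H"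
  have "x = g \<otimes> (inv g \<otimes> x \<otimes> g) \<otimes> inv g"
    using assms by (simp add: m_assoc inv_mult_cancel)
  then show "x \<in> conj_subgroup G g H" using * by (auto simp: conj_subgroup_eq)
qed

lemma conj_subgroup_subset:
  "H \<subseteq> carrier G \<Longrightarrow> g \<in> carrier G \<Longrightarrow> conj_subgroup G g H \<subseteq> carrier G"
  by (auto simp: conj_subgroup_eq)

lemma conj_subgroup_one: "H \<subseteq> carrier G \<Longrightarrow> conj_subgroup G \<one> H = H"
  by (force simp: conj_subgroup_eq image_iff)

lemma conj_subgroup_comp:
  assumes "H \<subseteq> carrier G" "g \<in> carrier G" "h \<in> carrier G"
  shows "conj_subgroup G g (conj_subgroup G h H) = conj_subgroup G (g \<otimes> h) H"
  unfolding conj_subgroup_eq image_image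
  by (rule image_cong) (use assms in \<open>auto simp: subset_iff m_assoc inv_mult_group\<close>)

lemma card_conj_subgroup:
  assumes "H \<subseteq> carrier G" "g \<in> carrier G"
  shows "card (conj_subgroup G g H) = card H"
  unfolding conj_subgroup_eq by (rule card_image) (use assms in \<open>auto simp: inj_on_def subset_iff\<close>)

lemma subgroup_conj_subgroup:
  assumes "subgroup H G" "g \<in> carrier G"
  shows "subgroup (conj_subgroup G g H) G"
proof -
  note H = subgroup.subset[OF assms(1)]
  note mem = mem_conj_subgroup_iff[OF H assms(2)]
  have carr: "x \<in> carrier G" if "x \<in> conj_subgroup G g H" for x
    using conj_subgroup_subset[OF H assms(2)] that by blast
  show ?thesis
  proof (rule subgroupI)
    show "conj_subgroup G g H \<subseteq> carrier G" by (rule conj_subgroup_subset[OF H assms(2)])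
    show "conj_subgroup G g H \<noteq> {}" using subgroup.one_closed[OF assms(1)] by (auto simp: conj_subgroup_eq)
  next
    fix x assume x: "x \<in> conj_subgroup G g H"
    have "inv g \<otimes> inv x \<otimes> g = inv (inv g \<otimes> x \<otimes> g)"
      using carr[OF x] assms(2) by (simp add: inv_mult_group m_assoc)
    then show "inv x \<in> conj_subgroup G g H"
      using mem[OF carr[OF x]] mem[of "inv x"] x carr[OF x] subgroup.m_inv_closed[OF assms(1)] by simp
  next
    fix x y assume x: "x \<in> conj_subgroup G g H" and y: "y \<in> conj_subgroup G g H"
    have "inv g \<otimes> (x \<otimes> y) \<otimes> g = (inv g \<otimes> x \<otimes> g) \<otimes> (inv g \<otimes> y \<otimes> g)"
      using carr[OF x] carr[OF y] assms(2) by (simp add: m_assoc inv_mult_cancel)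
    then show "x \<otimes> y \<in> conj_subgroup G g H"
      using mem[OF carr[OF x]] mem[OF carr[OF y]] mem[of "x \<otimes> y"] x y carr[OF x] carr[OF y]
        subgroup.m_closed[OF assms(1)] by simp
  qed
qed

lemma conj_class_self: "H \<subseteq> carrier G \<Longrightarrow> H \<in> conj_class G H"
  unfolding conj_class_def using conj_subgroup_one one_closed by blast

text \<open>Right translation by \<open>g\<close> permutes the carrier, so both classes run through
  the same conjugates.\<close>

lemma conj_class_conj_subgroup:
  assumes "H \<subseteq> carrier G" "g \<in> carrier G"
  shows "conj_class G (conj_subgroup G g H) = conj_class G H"
proof -
  have "conj_class G (conj_subgroup G g H) = (\<lambda>h. conj_subgroup G (h \<otimes> g) H) ` carrier G"
    unfolding conj_class_def Setcompr_eq_image using assms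
    by (intro image_cong) (simp_all add: conj_subgroup_comp)
  also have "\<dots> = (\<lambda>h. conj_subgroup G h H) ` ((\<lambda>h. h \<otimes> g) ` carrier G)"
    by (simp add: image_image)
  also have "(\<lambda>h. h \<otimes> g) ` carrier G = carrier G"
  proof
    show "carrier G \<subseteq> (\<lambda>h. h \<otimes> g) ` carrier G"
    proof
      fix h assume "h \<in> carrier G"
      then show "h \<in> (\<lambda>h. h \<otimes> g) ` carrier G"
        using assms(2) by (intro image_eqI[of _ _ "h \<otimes> inv g"]) (simp_all add: m_assoc)
    qed
  qed (use assms(2) in auto)
  finally show ?thesis by (auto simp: conj_class_def)
qed

lemma l_coset_eq_iff:
  assumes "subgroup H G" "x \<in> carrier G" "y \<in> carrier G"
  shows "x <# H = y <# H \<longleftrightarrow> inv y \<otimes> x \<in> H"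
proof
  assume "x <# H = y <# H"
  then show "inv y \<otimes> x \<in> H"
    using lcos_self[OF assms(2,1)] subgroup.lcos_module_imp[OF assms(1) is_group assms(3)] by blast
next
  assume *: "inv y \<otimes> x \<in> H"
  have "x = y \<otimes> (inv y \<otimes> x)" using assms by (simp add: inv_mult_cancel)
  then have "x \<in> y <# H" using * by (auto simp: l_coset_def)
  then show "x <# H = y <# H" using l_repr_independence[OF _ assms(3,1)] by blast
qed

end

section \<open>Fixed points on coset spaces\<close>

context finite_group
begin

lemma finite_gset_coset:
  assumes "subgroup H G"
  shows "finite_gset G (coset_gset G H)"
proof (rule finite_gsetI)
  note H = subgroup.subset[OF assms]
  show "finite (points (coset_gset G H))"
    using finite_subset[OF lcosets_subset_PowG[OF assms]] finite_carrier by (simp add: coset_gset_def)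
  have 1: "g <# C \<in> lcosets H" if "g \<in> carrier G" "C \<in> lcosets H" for g C
    using that H by (auto simp: LCOSETS_def lcos_m_assoc)
  have 2: "C \<subseteq> carrier G" if "C \<in> lcosets H" for C
    using that H by (auto simp: LCOSETS_def l_coset_def)
  show "acts_on G (points (coset_gset G H)) (action (coset_gset G H))"
    unfolding acts_on_def coset_gset_def using 1 2 by (auto simp: lcos_m_assoc lcos_mult_one)
qed (simp add: coset_gset_def)

text \<open>A coset aH is fixed by \<open>K\<close> iff \<open>K\<close> lies in the conjugate of
  \<open>H\<close> by a, so the fixed cosets partition the set counted on the right into pieces of
  size |H|. Keeping |H| as a factor avoids a division.\<close>

lemma num_fixed_coset_gset:
  assumes H: "subgroup H G" and K: "K \<subseteq> carrier G"
  shows "num_fixed (coset_gset G H) K * int (card H) =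
    int (card {a \<in> carrier G. K \<subseteq> conj_subgroup G a H})"
proof -
  let ?F = "fixed_points (coset_gset G H) K"
  note HG = subgroup.subset[OF H]
  have F: "a <# H \<in> ?F \<longleftrightarrow> K \<subseteq> conj_subgroup G a H" if a: "a \<in> carrier G" for a
  proof -
    have L: "a <# H \<in> lcosets H" using a by (auto simp: LCOSETS_def)
    have "k <# (a <# H) = a <# H \<longleftrightarrow> k \<in> conj_subgroup G a H" if "k \<in> K" for k
    proof -
      have k: "k \<in> carrier G" using that K by blast
      then show ?thesis
        using a HG by (simp add: lcos_m_assoc l_coset_eq_iff[OF H] mem_conj_subgroup_iff m_assoc)
    qed
    then show ?thesis using L by (auto simp: fixed_points_def coset_gset_def)
  qed
  have sub: "?F \<subseteq> lcosets H" by (auto simp: fixed_points_def coset_gset_def)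
  have eq: "C = c <# H \<and> c \<in> carrier G" if C: "C \<in> lcosets H" and c: "c \<in> C" for C c
  proof -
    obtain x where x: "x \<in> carrier G" "C = x <# H" using C by (auto simp: LCOSETS_def)
    then have "c \<in> carrier G" using l_coset_subset_G[OF HG x(1)] c by blast
    then show ?thesis using l_repr_independence[OF _ x(1) H] c x(2) by blast
  qed
  have U: "\<Union> ?F = {a \<in> carrier G. K \<subseteq> conj_subgroup G a H}"
  proof (intro equalityI subsetI)
    fix a assume "a \<in> \<Union> ?F"
    then obtain C where C: "C \<in> ?F" "a \<in> C" by blast
    then have "C = a <# H" "a \<in> carrier G" using eq sub by blast+
    then show "a \<in> {a \<in> carrier G. K \<subseteq> conj_subgroup G a H}" using F C by simp
  next
    fix a assume "a \<in> {a \<in> carrier G. K \<subseteq> conj_subgroup G a H}"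
    then have "a <# H \<in> ?F" "a \<in> a <# H" using F lcos_self[OF _ H] by simp_all
    then show "a \<in> \<Union> ?F" by blast
  qed
  have "card H * card ?F = card (\<Union> ?F)"
  proof (rule card_partition)
    show "finite ?F" using finite_gsetD(1)[OF finite_gset_coset[OF H]] by (simp add: fixed_points_def)
    show "finite (\<Union> ?F)" unfolding U using finite_carrier by simp
    show "card C = card H" if "C \<in> ?F" for C
      using l_card_cosets_equal[OF subsetD[OF sub that] HG finite_carrier] by simp
    show "C \<inter> C' = {}" if "C \<in> ?F" "C' \<in> ?F" "C \<noteq> C'" for C C'
      using lcos_disjoint[OF H] that sub by blast
  qed
  then show ?thesis unfolding U num_fixed_def by (metis of_nat_mult mult.commute)
qed

lemma card_subgroup_pos: "subgroup H G \<Longrightarrow> card H > 0"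
  using finite_subset[OF subgroup.subset finite_carrier] subgroup.one_closed by (fastforce simp: card_gt_0_iff)

text \<open>Right multiplication by \<open>g\<close> matches the elements counted for the conjugate
  with those counted for \<open>H\<close>.\<close>

lemma num_fixed_coset_conj_subgroup:
  assumes H: "subgroup H G" and g: "g \<in> carrier G" and K: "K \<subseteq> carrier G"
  shows "num_fixed (coset_gset G (conj_subgroup G g H)) K = num_fixed (coset_gset G H) K"
proof -
  note HG = subgroup.subset[OF H]
  have "bij_betw (\<lambda>a. a \<otimes> g) {a \<in> carrier G. K \<subseteq> conj_subgroup G a (conj_subgroup G g H)}
     {a \<in> carrier G. K \<subseteq> conj_subgroup G a H}"
    by (rule bij_betw_byWitness[where f' = "\<lambda>a. a \<otimes> inv g"])
      (use g HG in \<open>auto simp: conj_subgroup_comp m_assoc\<close>)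
  then have "num_fixed (coset_gset G (conj_subgroup G g H)) K * int (card H) = num_fixed (coset_gset G H) K * int (card H)"
    using num_fixed_coset_gset[OF H K] num_fixed_coset_gset[OF subgroup_conj_subgroup[OF H g] K]
    by (simp add: card_conj_subgroup[OF HG g] bij_betw_same_card)
  then show ?thesis using card_subgroup_pos[OF H] by simp
qed

text \<open>The support of the table of marks is subconjugacy. This gives the triangularity and the
  vanishing for subgroups not above \<open>N\<close>.\<close>

lemma num_fixed_coset_nonzero_iff:
  assumes "subgroup H G" "K \<subseteq> carrier G"
  shows "num_fixed (coset_gset G H) K \<noteq> 0 \<longleftrightarrow> (\<exists>a\<in>carrier G. K \<subseteq> conj_subgroup G a H)"
proof -
  have "finite {a \<in> carrier G. K \<subseteq> conj_subgroup G a H}" using finite_carrier by simp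
  then have "card {a \<in> carrier G. K \<subseteq> conj_subgroup G a H} \<noteq> 0 \<longleftrightarrow> (\<exists>a\<in>carrier G. K \<subseteq> conj_subgroup G a H)"
    by auto
  moreover have "num_fixed (coset_gset G H) K \<noteq> 0 \<longleftrightarrow> num_fixed (coset_gset G H) K * int (card H) \<noteq> 0"
    using card_subgroup_pos[OF assms(1)] by simp
  ultimately show ?thesis
    unfolding num_fixed_coset_gset[OF assms] of_nat_eq_0_iff by simp
qed

text \<open>Count the pairs \<open>(g, a)\<close> with \<open>g \<in> aHa\<^sup>-\<^sup>1\<close> in two ways.\<close>

lemma sum_num_fixed_coset_cyclic:
  assumes H: "subgroup H G"
  shows "(\<Sum>g\<in>carrier G. num_fixed (coset_gset G H) (generate G {g})) = int (order G)"
proof -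
  note HG = subgroup.subset[OF H]
  let ?h = "int (card H)"
  \<comment> \<open>A cyclic subgroup enters the counting formula only through its generator, which
    turns the sum of marks into a count of pairs.\<close>
  have "generate G {g} \<subseteq> conj_subgroup G a H \<longleftrightarrow> g \<in> conj_subgroup G a H"
    if "g \<in> carrier G" "a \<in> carrier G" for g a
    using generate_subgroup_incl[OF _ subgroup_conj_subgroup[OF H that(2)], of "{g}"]
      generate.incl[of g "{g}" G] by blast
  then have "num_fixed (coset_gset G H) (generate G {g}) * ?h = int (card {a \<in> carrier G. g \<in> conj_subgroup G a H})"
    if "g \<in> carrier G" for g
    using num_fixed_coset_gset[OF H generate_incl[of "{g}"]] that by (simp cong: conj_cong)
  then have "(\<Sum>g\<in>carrier G. num_fixed (coset_gset G H) (generate G {g})) * ?h =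
      (\<Sum>g\<in>carrier G. int (card {a \<in> carrier G. g \<in> conj_subgroup G a H}))"
    by (simp add: sum_distrib_right)
  also have "\<dots> = (\<Sum>a\<in>carrier G. int (card {g \<in> carrier G. g \<in> conj_subgroup G a H}))"
    using sum_multicount_gen[OF finite_carrier finite_carrier,
        of "\<lambda>g a. g \<in> conj_subgroup G a H" "\<lambda>a. card {g \<in> carrier G. g \<in> conj_subgroup G a H}"]
    by (simp flip: of_nat_sum)
  also have "\<dots> = (\<Sum>a\<in>carrier G. ?h)"
  proof (rule sum.cong)
    fix a assume a: "a \<in> carrier G"
    then have "{g \<in> carrier G. g \<in> conj_subgroup G a H} = conj_subgroup G a H"
      using conj_subgroup_subset[OF HG] by blast
    then show "int (card {g \<in> carrier G. g \<in> conj_subgroup G a H}) = ?h"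
      using card_conj_subgroup[OF HG a] by simp
  qed simp
  also have "\<dots> = int (order G) * ?h" by (simp add: order_def)
  finally show ?thesis using card_subgroup_pos[OF H] by simp
qed

lemma transitive_class_eq:
  assumes "subgroup H G"
  shows "transitive_class G (conj_class G H) = gset_class G (coset_gset G H)"
  unfolding transitive_class_def
proof (rule the_elem_image_const)
  note HG = subgroup.subset[OF assms]
  show "conj_class G H \<noteq> {}" using conj_class_self[OF HG] by blast
  fix H' assume "H' \<in> conj_class G H"
  then obtain g where g: "g \<in> carrier G" "H' = conj_subgroup G g H" by (auto simp: conj_class_def)
  then have "subgroup H' G" using subgroup_conj_subgroup[OF assms] by simp
  then show "gset_class G (coset_gset G H') = gset_class G (coset_gset G H)"
    using num_fixed_coset_conj_subgroup[OF assms g(1) subgroup.subset] g(2) assms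
    by (auto simp: gset_class_def virtual_class_eq finite_gset_coset finite_gset_empty)
qed

lemma transitive_class_closed:
  "subgroup H G \<Longrightarrow> transitive_class G (conj_class G H) \<in> carrier (burnside_ring G)"
  by (simp add: transitive_class_eq gset_class_def virtual_class_closed finite_gset_coset finite_gset_empty)

lemma ghost_transitive_class:
  "subgroup H G \<Longrightarrow> subgroup K G \<Longrightarrow>
    ghost K (transitive_class G (conj_class G H)) = num_fixed (coset_gset G H) K"
  by (simp add: transitive_class_eq gset_class_def ghost_virtual_class finite_gset_coset finite_gset_empty)

end

section \<open>Coordinates relative to a family of subgroups\<close>

locale subgroup_family = finite_group +
  fixes D :: "'a set set"
  assumes subgroups: "\<And>H. H \<in> D \<Longrightarrow> subgroup H G"
begin

lemma finite_family: "finite D"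
  by (rule finite_subset[of _ "Pow (carrier G)"]) (use subgroups subgroup.subset finite_carrier in auto)

lemma finite_classes: "finite (collection_classes G D)"
  by (simp add: collection_classes_def finite_family)

lemma burnside_comb_closed: "burnside_comb G D a \<in> carrier (burnside_ring G)"
  unfolding burnside_comb_def
  by (intro burnside.finsum_closed)
    (auto simp: collection_classes_def transitive_class_closed subgroups)

lemma ghost_burnside_comb:
  assumes "subgroup K G"
  shows "ghost K (burnside_comb G D a) =
    (\<Sum>C\<in>collection_classes G D. a C * ghost K (transitive_class G C))"
proof -
  have c: "transitive_class G C \<in> carrier (burnside_ring G)" if "C \<in> collection_classes G D" for C
    using that by (auto simp: collection_classes_def transitive_class_closed subgroups)
  show ?thesis
    unfolding burnside_comb_def
    by (subst ghost_finsum) (use c assms in \<open>auto simp: finite_classes ghost_int_smult\<close>)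
qed

text \<open>
  The table of marks is triangular: among the classes on which the coefficients differ,
  evaluate the mark at a subgroup of maximal order.
\<close>

lemma burnside_comb_inj:
  assumes eq: "burnside_comb G D a = burnside_comb G D b" and C: "C \<in> collection_classes G D"
  shows "a C = b C"
proof (rule ccontr)
  assume neq: "a C \<noteq> b C"
  \<comment> \<open>Subgroups rather than classes are collected, so that orders can be
    compared.\<close>
  define T where "T = {H \<in> D. a (conj_class G H) \<noteq> b (conj_class G H)}"
  have T: "finite T" "T \<noteq> {}" "T \<subseteq> D"
    using finite_family C neq by (auto simp: T_def collection_classes_def)
  have "Max (card ` T) \<in> card ` T" using T by simp
  then obtain H where H: "H \<in> T" "Max (card ` T) = card H" by auto
  then have H_max: "card L \<le> card H" if "L \<in> T" for L
    using that T(1) by (metis Max_ge finite_imageI imageI)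
  have HD: "H \<in> D" and sH: "subgroup H G" using H(1) T(3) subgroups by auto
  have HG: "H \<subseteq> carrier G" using sH subgroup.subset by blast
  have "0 = ghost H (burnside_comb G D a) - ghost H (burnside_comb G D b)" using eq by simp
  also have "\<dots> = (\<Sum>C\<in>collection_classes G D. (a C - b C) * ghost H (transitive_class G C))"
    by (simp add: ghost_burnside_comb sH sum_subtractf left_diff_distrib)
  also have "\<dots> = (\<Sum>C\<in>{conj_class G H}. (a C - b C) * ghost H (transitive_class G C))"
  proof (rule sum.mono_neutral_right)
    show "\<forall>C\<in>collection_classes G D - {conj_class G H}. (a C - b C) * ghost H (transitive_class G C) = 0"
    proof (intro ballI, rule ccontr)
      fix C assume C: "C \<in> collection_classes G D - {conj_class G H}"
        and nz: "(a C - b C) * ghost H (transitive_class G C) \<noteq> 0"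
      obtain L where L: "L \<in> D" "C = conj_class G L" using C by (auto simp: collection_classes_def)
      have sL: "subgroup L G" using L subgroups by blast
      have LG: "L \<subseteq> carrier G" using sL subgroup.subset by blast
      \<comment> \<open>A surviving term has \<open>L\<close> in \<open>T\<close> and
        \<open>H\<close> inside a conjugate of \<open>L\<close>. Maximality makes the two equal, so
        the term belongs to the class of \<open>H\<close> after all.\<close>
      have "num_fixed (coset_gset G L) H \<noteq> 0"
        using nz L by (auto simp: ghost_transitive_class sL sH)
      then obtain g where g: "g \<in> carrier G" "H \<subseteq> conj_subgroup G g L"
        using num_fixed_coset_nonzero_iff[OF sL HG] by blast
      have "card (conj_subgroup G g L) \<le> card H"
        using H_max[of L] nz L card_conj_subgroup[OF LG g(1)] by (auto simp: T_def)
      then have "H = conj_subgroup G g L"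
        using g conj_subgroup_subset[OF LG g(1)] finite_subset[OF _ finite_carrier] by (intro card_seteq) auto
      then show False using C L conj_class_conj_subgroup[OF LG g(1)] by simp
    qed
  qed (use finite_classes HD in \<open>auto simp: collection_classes_def\<close>)
  also have "\<dots> = (a (conj_class G H) - b (conj_class G H)) * num_fixed (coset_gset G H) H"
    by (simp add: ghost_transitive_class sH)
  \<comment> \<open>Only the diagonal term is left, and its mark cannot vanish because
    \<open>H\<close> fixes its own coset.\<close>
  finally have "num_fixed (coset_gset G H) H = 0" using H(1) by (auto simp: T_def)
  then show False
    using num_fixed_coset_nonzero_iff[OF sH HG] conj_subgroup_one[OF HG] one_closed by auto
qed

text \<open>Injectivity of \<open>burnside_comb\<close> pins down the coefficients on the classes;
  \<open>restrict\<close> supplies \<open>undefined\<close> elsewhere, as the extensionality clause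
  of \<open>burnside_coeff\<close> requires.\<close>

lemma burnside_coeff_comb:
  "burnside_coeff G D (burnside_comb G D a) = restrict a (collection_classes G D)"
  unfolding burnside_coeff_def
proof (rule the_equality)
  have "burnside_comb G D a = burnside_comb G D (restrict a (collection_classes G D))"
    by (rule burnside_eqI) (auto simp: burnside_comb_closed ghost_burnside_comb)
  then show "restrict a (collection_classes G D) \<in> extensional (collection_classes G D) \<and>
      burnside_comb G D a = burnside_comb G D (restrict a (collection_classes G D))" by simp
next
  fix b assume "b \<in> extensional (collection_classes G D) \<and> burnside_comb G D a = burnside_comb G D b"
  then show "b = restrict a (collection_classes G D)"
    using burnside_comb_inj[of a b] by (intro extensionalityI[of _ "collection_classes G D"]) auto
qed

lemma coeffsum_comb: "coeffsum G D (burnside_comb G D a) = (\<Sum>C\<in>collection_classes G D. a C)"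
  by (simp add: coeffsum_def burnside_coeff_comb)

lemma burnside_comb_carrier: "burnside_comb G D a \<in> carrier (partial_burnside_ring G D)"
  by (simp add: partial_burnside_ring_def)

lemma partial_burnside_ringE:
  assumes "x \<in> carrier (partial_burnside_ring G D)"
  obtains a where "x = burnside_comb G D a"
  using assms by (auto simp: partial_burnside_ring_def)

text \<open>By linearity only transitive sets have to be considered, and their marks at cyclic
  subgroups average to one, the number of orbits.\<close>

lemma sum_ghost_cyclic:
  assumes "x \<in> carrier (partial_burnside_ring G D)"
  shows "(\<Sum>g\<in>carrier G. ghost (generate G {g}) x) = int (order G) * coeffsum G D x"
proof -
  obtain a where a: "x = burnside_comb G D a" using partial_burnside_ringE[OF assms] .
  have gen: "subgroup (generate G {g}) G" if "g \<in> carrier G" for g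
    using that by (intro generate_is_subgroup) auto
  have "(\<Sum>g\<in>carrier G. ghost (generate G {g}) x) =
      (\<Sum>C\<in>collection_classes G D. \<Sum>g\<in>carrier G. a C * ghost (generate G {g}) (transitive_class G C))"
    unfolding a by (subst sum.swap) (simp add: ghost_burnside_comb gen)
  also have "\<dots> = (\<Sum>C\<in>collection_classes G D. a C * int (order G))"
  proof (rule sum.cong)
    fix C assume "C \<in> collection_classes G D"
    then obtain H where "subgroup H G" "C = conj_class G H"
      using subgroups by (auto simp: collection_classes_def)
    then show "(\<Sum>g\<in>carrier G. a C * ghost (generate G {g}) (transitive_class G C)) = a C * int (order G)"
      by (simp add: ghost_transitive_class gen sum_num_fixed_coset_cyclic flip: sum_distrib_left)
  qed simp
  finally show ?thesis by (simp add: a coeffsum_comb sum_distrib_left mult.commute)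
qed

end

section \<open>Fixed points of a normal subgroup\<close>

lemma (in group) subgroup_core_eq: "subgroup_core G H = \<Inter> (conj_class G H)"
  by (auto simp: subgroup_core_def conj_class_def)

text \<open>Turns counts of cosets in the quotient into counts of elements of \<open>G\<close>, at
  the cost of a factor |N|.\<close>

lemma (in finite_group) card_Union_rcosets:
  assumes "subgroup N G" "S \<subseteq> rcosets N"
  shows "card (\<Union> S) = card N * card S"
proof -
  note NG = subgroup.subset[OF assms(1)]
  have "finite (rcosets N)"
    using finite_subset[OF rcosets_subset_PowG[OF assms(1)]] finite_carrier by simp
  then have finS: "finite S" using assms(2) finite_subset by blast
  have "card N * card S = card (\<Union> S)"
  proof (rule card_partition[OF finS])
    have "\<Union> S \<subseteq> carrier G" using Union_mono[OF assms(2)] rcosets_part_G[OF assms(1)] by simp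
    then show "finite (\<Union> S)" using finite_carrier finite_subset by blast
    show "card C = card N" if "C \<in> S" for C
      using card_rcosets_equal[OF subsetD[OF assms(2) that] NG] by simp
    show "C \<inter> C' = {}" if "C \<in> S" "C' \<in> S" "C \<noteq> C'" for C C'
      using pairwiseD[OF rcos_disjoint[OF assms(1)], of C C'] that assms(2) by (auto simp: disjnt_def)
  qed
  then show ?thesis by simp
qed

section \<open>The correspondence of subgroups modulo N\<close>

locale collection_quotient = finite_group +
  fixes D :: "'a set set" and N :: "'a set"
  assumes collection: "collection G D" and N_in: "N \<in> D" and N_normal: "N \<lhd> G"
begin

sublocale subgroup_family G D
  by (intro subgroup_family.intro subgroup_family_axioms.intro finite_group_axioms)
    (use collection in \<open>simp add: collection_def\<close>)

sublocale N: normal N G by (rule N_normal)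

abbreviation Q :: "'a set monoid" where "Q \<equiv> G Mod N"

abbreviation proj :: "'a \<Rightarrow> 'a set" where "proj g \<equiv> N #> g"

abbreviation D' :: "'a set set set" where "D' \<equiv> quotient_collection G D N"

lemma proj_hom: "group_hom G Q proj"
  by (simp add: group_hom_def group_hom_axioms_def is_group N.factorgroup_is_group N.r_coset_hom_Mod)

sublocale Q: finite_group Q
  by (intro finite_group.intro finite_group_axioms.intro N.factorgroup_is_group)
    (simp add: carrier_FactGroup finite_carrier)

sublocale P: group_hom G Q proj by (rule proj_hom)

lemma coset_eq_proj: "C \<in> carrier Q \<Longrightarrow> g \<in> C \<Longrightarrow> g \<in> carrier G \<and> C = proj g"
proof -
  assume C: "C \<in> carrier Q" and g: "g \<in> C"
  then obtain x where x: "x \<in> carrier G" "C = proj x" by (auto simp: carrier_FactGroup)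
  then have "g \<in> carrier G" using r_coset_subset_G[OF N.subset x(1)] g by blast
  then show ?thesis using repr_independence[OF _ x(1) N.subgroup_axioms] g x(2) by blast
qed

lemma proj_self: "g \<in> carrier G \<Longrightarrow> g \<in> proj g"
  by (rule rcos_self[OF _ N.subgroup_axioms])

text \<open>A subgroup above \<open>N\<close> is a union of cosets of \<open>N\<close>, so taking
  unions inverts the passage to its image.\<close>

lemma Union_proj_image:
  assumes "subgroup H G" "N \<subseteq> H"
  shows "\<Union> (proj ` H) = H"
proof
  show "\<Union> (proj ` H) \<subseteq> H"
    using assms subgroup.m_closed[OF assms(1)] by (auto simp: r_coset_def)
  show "H \<subseteq> \<Union> (proj ` H)"
    using proj_self subgroup.subset[OF assms(1)] by blast
qed

lemma conj_proj_image:
  assumes "H \<subseteq> carrier G" "g \<in> carrier G"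
  shows "conj_subgroup Q (proj g) (proj ` H) = proj ` conj_subgroup G g H"
  unfolding Q.conj_subgroup_eq conj_subgroup_eq image_image
  using assms by (intro image_cong) (simp_all add: subset_iff P.hom_mult P.hom_inv del: mult_FactGroup)

text \<open>Conjugation maps \<open>N\<close> to itself, so it cannot change whether a subgroup
  contains \<open>N\<close>. Being above \<open>N\<close> is thus a property of the conjugacy
  class.\<close>

lemma N_subset_conj_iff:
  assumes "H \<subseteq> carrier G" "g \<in> carrier G"
  shows "N \<subseteq> conj_subgroup G g H \<longleftrightarrow> N \<subseteq> H"
proof -
  have *: "N \<subseteq> conj_subgroup G g H" if "N \<subseteq> H" "H \<subseteq> carrier G" "g \<in> carrier G" for g H
    using subsetD[OF that(1) N.inv_op_closed1] that by (auto simp: mem_conj_subgroup_iff)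
  have "conj_subgroup G (inv g) (conj_subgroup G g H) = H"
    using assms by (simp add: conj_subgroup_comp conj_subgroup_one)
  then show ?thesis
    using *[OF _ assms] *[OF _ conj_subgroup_subset[OF assms], of "inv g"] assms(2) by auto
qed

text \<open>The members of \<open>K\<close> are cosets of \<open>N\<close>, hence the preimage under
  \<open>proj\<close> is simply \<open>\<Union> K\<close>. At this subgroup of \<open>G\<close> the
  marks of \<open>x\<close> are evaluated.\<close>

lemma preimage:
  assumes "subgroup K Q"
  shows "subgroup (\<Union> K) G" "N \<subseteq> \<Union> K" and "C \<in> K \<Longrightarrow> g \<in> C \<Longrightarrow> g \<in> carrier G \<and> C = proj g"
proof -
  show C: "g \<in> carrier G \<and> C = proj g" if "C \<in> K" "g \<in> C" for C g
    using coset_eq_proj subgroup.subset[OF assms] that by blast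
  have mem: "g \<in> \<Union> K \<longleftrightarrow> g \<in> carrier G \<and> proj g \<in> K" for g
    using C proj_self by blast
  have N: "N \<in> K" using subgroup.one_closed[OF assms] by simp
  then show "N \<subseteq> \<Union> K" by blast
  show "subgroup (\<Union> K) G"
  proof (rule subgroupI)
    show "\<Union> K \<subseteq> carrier G" using C by blast
    show "\<Union> K \<noteq> {}" using N N.one_closed by blast
    show "inv g \<in> \<Union> K" if "g \<in> \<Union> K" for g
    proof -
      have g: "g \<in> carrier G" "proj g \<in> K" using that mem by blast+
      then have "proj (inv g) \<in> K" using subgroup.m_inv_closed[OF assms] P.hom_inv by metis
      then show ?thesis using mem g(1) inv_closed by blast
    qed
    show "g \<otimes> h \<in> \<Union> K" if "g \<in> \<Union> K" "h \<in> \<Union> K" for g h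
    proof -
      have gh: "g \<in> carrier G" "proj g \<in> K" "h \<in> carrier G" "proj h \<in> K" using that mem by blast+
      then have "proj (g \<otimes> h) \<in> K" using subgroup.m_closed[OF assms gh(2,4)] P.hom_mult by metis
      then show ?thesis using mem gh m_closed by blast
    qed
  qed
qed

section \<open>Passage to the fixed points of N\<close>

lemma fixed_points_N_closed:
  assumes X: "finite_gset G X" and g: "g \<in> carrier G" and x: "x \<in> fixed_points X N"
  shows "action X g x \<in> fixed_points X N"
proof -
  note a = finite_gsetD(2)[OF X]
  have xp: "x \<in> points X" using x by (simp add: fixed_points_def)
  have "action X n (action X g x) = action X g x" if n: "n \<in> N" for n
  proof -
    have nG: "n \<in> carrier G" using n N.subset by blast
    have "inv g \<otimes> n \<otimes> g \<in> N" using N.inv_op_closed1[OF g n] .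
    then have m: "action X (inv g \<otimes> n \<otimes> g) x = x" "inv g \<otimes> n \<otimes> g \<in> carrier G"
      using x N.subset by (auto simp: fixed_points_def)
    \<comment> \<open>Normality moves \<open>n\<close> past \<open>g\<close> as a conjugate, which
      lies in \<open>N\<close> and so fixes \<open>x\<close>.\<close>
    have "n \<otimes> g = g \<otimes> (inv g \<otimes> n \<otimes> g)" using nG g by (simp add: m_assoc inv_mult_cancel)
    then have "action X n (action X g x) = action X (g \<otimes> (inv g \<otimes> n \<otimes> g)) x"
      using acts_on_mult[OF a nG g xp] by metis
    also have "\<dots> = action X g x" using acts_on_mult[OF a g m(2) xp] m(1) by simp
    finally show ?thesis .
  qed
  then show ?thesis using a g xp by (simp add: fixed_points_def acts_on_def)
qed

text \<open>Elements of one coset differ by left factors from \<open>N\<close>, and these fix the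
  point \<open>action X g x\<close>; hence the \<open>the_elem\<close> in \<open>fixed_gset\<close>
  is well defined.\<close>

lemma action_fixed_gset:
  assumes X: "finite_gset G X" and g: "g \<in> carrier G" and x: "x \<in> fixed_points X N"
  shows "action (fixed_gset G N X) (proj g) x = action X g x"
proof -
  have "the_elem ((\<lambda>h. action X h x) ` proj g) = action X g x"
  proof (rule the_elem_image_const)
    show "proj g \<noteq> {}" using proj_self[OF g] by blast
    fix h assume "h \<in> proj g"
    then obtain n where n: "n \<in> N" "h = n \<otimes> g" by (auto simp: r_coset_def)
    have nG: "n \<in> carrier G" using n N.subset by blast
    have "x \<in> points X" using x by (simp add: fixed_points_def)
    then have "action X h x = action X n (action X g x)"
      using finite_gsetD(2)[OF X] n(2) nG g by (simp add: acts_on_def)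
    then show "action X h x = action X g x"
      using fixed_points_N_closed[OF X g x] n(1) by (simp add: fixed_points_def)
  qed
  then show ?thesis using x by (simp add: fixed_gset_def)
qed

lemma finite_gset_fixed:
  assumes X: "finite_gset G X"
  shows "finite_gset Q (fixed_gset G N X)"
proof (rule Q.finite_gsetI)
  note a = finite_gsetD(2)[OF X]
  have p: "points (fixed_gset G N X) = fixed_points X N" by (simp add: fixed_gset_def)
  have f: "x \<in> points X" if "x \<in> fixed_points X N" for x using that by (simp add: fixed_points_def)
  show "finite (points (fixed_gset G N X))"
    using finite_gsetD(1)[OF X] by (simp add: p fixed_points_def)
  show "action (fixed_gset G N X) C \<in> extensional (points (fixed_gset G N X))" for C
    by (simp add: fixed_gset_def)
  show "acts_on Q (points (fixed_gset G N X)) (action (fixed_gset G N X))"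
    unfolding acts_on_def p
  proof (intro conjI ballI)
    fix C x assume C: "C \<in> carrier Q" and x: "x \<in> fixed_points X N"
    then obtain g where g: "g \<in> carrier G" "C = proj g" by (auto simp: carrier_FactGroup)
    show "action (fixed_gset G N X) C x \<in> fixed_points X N"
      using action_fixed_gset[OF X g(1) x] fixed_points_N_closed[OF X g(1) x] g(2) by simp
    fix B assume B: "B \<in> carrier Q"
    then obtain h where h: "h \<in> carrier G" "B = proj h" by (auto simp: carrier_FactGroup)
    let ?a = "action (fixed_gset G N X)"
    have "B \<otimes>\<^bsub>Q\<^esub> C = proj (h \<otimes> g)"
      unfolding g(2) h(2) using P.hom_mult[OF h(1) g(1)] by (rule sym)
    then have "?a (B \<otimes>\<^bsub>Q\<^esub> C) x = action X (h \<otimes> g) x"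
      using action_fixed_gset[OF X m_closed[OF h(1) g(1)] x] by metis
    also have "\<dots> = action X h (action X g x)"
      by (rule acts_on_mult[OF a h(1) g(1) f[OF x]])
    also have "\<dots> = ?a B (?a C x)"
      using action_fixed_gset[OF X h(1) fixed_points_N_closed[OF X g(1) x]]
        action_fixed_gset[OF X g(1) x] by (simp add: g(2) h(2))
    finally show "?a (B \<otimes>\<^bsub>Q\<^esub> C) x = ?a B (?a C x)" .
  next
    fix x assume x: "x \<in> fixed_points X N"
    then show "action (fixed_gset G N X) \<one>\<^bsub>Q\<^esub> x = x"
      using action_fixed_gset[OF X one_closed x] P.hom_one a f by (simp add: acts_on_def)
  qed
qed

text \<open>A coset acts as each of its elements does, so being fixed by \<open>K\<close> means
  being fixed by all of \<open>\<Union> K\<close>. As this contains \<open>N\<close>, the points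
  counted on the right are automatically \<open>N\<close>-fixed.\<close>

lemma num_fixed_fixed_gset:
  assumes X: "finite_gset G X" and K: "subgroup K Q"
  shows "num_fixed (fixed_gset G N X) K = num_fixed X (\<Union> K)"
proof -
  have "x \<in> fixed_points (fixed_gset G N X) K \<longleftrightarrow> x \<in> fixed_points X (\<Union> K)" for x
  proof (cases "x \<in> fixed_points X N")
    case True
    have "action (fixed_gset G N X) C x = x \<longleftrightarrow> (\<forall>g\<in>C. action X g x = x)" if C: "C \<in> K" for C
    proof -
      obtain c where c: "c \<in> carrier G" "C = proj c"
        using C subgroup.subset[OF K] by (auto simp: carrier_FactGroup)
      have "action (fixed_gset G N X) C x = action X g x" if "g \<in> C" for g
        using preimage(3)[OF K C that] action_fixed_gset[OF X _ True] by metis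
      then show ?thesis using proj_self[OF c(1)] c(2) by metis
    qed
    then show ?thesis using True by (auto simp: fixed_points_def fixed_gset_def)
  next
    case False
    then show ?thesis using preimage(2)[OF K] by (auto simp: fixed_points_def fixed_gset_def)
  qed
  then have "fixed_points (fixed_gset G N X) K = fixed_points X (\<Union> K)" by blast
  then show ?thesis by (simp add: num_fixed_def)
qed

text \<open>The marks of the image depend only on those of \<open>x\<close>, not on the
  representative, which makes the \<open>the_elem\<close> in \<open>fixed_hom\<close> well
  defined.\<close>

lemma fixed_hom_ghost:
  assumes "x \<in> carrier (partial_burnside_ring G D)"
  shows "fixed_hom G D N x \<in> carrier (burnside_ring Q)"
    and "subgroup K Q \<Longrightarrow> ghost K (fixed_hom G D N x) = ghost (\<Union> K) x"
proof -
  have x: "x \<in> carrier (burnside_ring G)"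
    using partial_burnside_ringE[OF assms] burnside_comb_closed by metis
  note r = burnside_repr[OF x]
  let ?f = "\<lambda>(X, Y). virtual_class Q (fixed_gset G N X) (fixed_gset G N Y)"
  have f: "?f (X, Y) \<in> carrier (burnside_ring Q)"
    "subgroup K Q \<Longrightarrow> ghost K (?f (X, Y)) = ghost (\<Union> K) x" if "(X, Y) \<in> x" for X Y K
    using r(2-4)[OF that] preimage(1)
    by (simp_all add: Q.virtual_class_closed Q.ghost_virtual_class finite_gset_fixed num_fixed_fixed_gset)
  obtain X Y where XY: "(X, Y) \<in> x" using r(1) by auto
  have "fixed_hom G D N x = the_elem (?f ` x)" using assms by (simp add: fixed_hom_def)
  also have "\<dots> = ?f (X, Y)"
  proof (rule the_elem_image_const)
    fix p assume p: "p \<in> x"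
    obtain U V where "p = (U, V)" by fastforce
    then show "?f p = ?f (X, Y)"
      using f[OF XY] f[of U V] p by (intro Q.burnside_eqI) simp_all
  qed (rule r(1))
  finally show "fixed_hom G D N x \<in> carrier (burnside_ring Q)"
    "subgroup K Q \<Longrightarrow> ghost K (fixed_hom G D N x) = ghost (\<Union> K) x"
    using f[OF XY] by simp_all
qed

text \<open>Both sides obey the counting formula. The cosets counted in the quotient have as union
  the elements counted in \<open>G\<close>, and \<open>H\<close> is the union of its image, so
  numerator and denominator both change by the factor |N|.\<close>

lemma num_fixed_coset_quotient:
  assumes H: "subgroup H G" "N \<subseteq> H" and K: "subgroup K Q"
  shows "num_fixed (coset_gset Q (proj ` H)) K = num_fixed (coset_gset G H) (\<Union> K)"
proof -
  note HG = subgroup.subset[OF H(1)] and KG = subgroup.subset[OF preimage(1)[OF K]]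
  have HQ: "subgroup (proj ` H) Q" using P.subgroup_img_is_subgroup[OF H(1)] .
  have carrier_eq: "carrier Q = rcosets N" by (simp add: FactGroup_def)
  let ?S = "{A \<in> carrier Q. K \<subseteq> conj_subgroup Q A (proj ` H)}"
  have iff: "K \<subseteq> conj_subgroup Q (proj a) (proj ` H) \<longleftrightarrow> \<Union> K \<subseteq> conj_subgroup G a H"
    if a: "a \<in> carrier G" for a
  proof -
    let ?L = "conj_subgroup G a H"
    have L: "subgroup ?L G" "N \<subseteq> ?L"
      using subgroup_conj_subgroup[OF H(1) a] N_subset_conj_iff[OF HG a] H(2) by auto
    have "K \<subseteq> proj ` ?L \<longleftrightarrow> \<Union> K \<subseteq> ?L"
    proof
      assume "K \<subseteq> proj ` ?L"
      then have "\<Union> K \<subseteq> \<Union> (proj ` ?L)" by blast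
      then show "\<Union> K \<subseteq> ?L" using Union_proj_image[OF L] by simp
    next
      assume L': "\<Union> K \<subseteq> ?L"
      show "K \<subseteq> proj ` ?L"
      proof
        fix C assume C: "C \<in> K"
        then obtain c where "c \<in> carrier G" "C = proj c"
          using subgroup.subset[OF K] by (auto simp: carrier_FactGroup)
        then show "C \<in> proj ` ?L" using C L' proj_self by blast
      qed
    qed
    then show ?thesis using conj_proj_image[OF HG a] by simp
  qed
  have U: "\<Union> ?S = {a \<in> carrier G. \<Union> K \<subseteq> conj_subgroup G a H}"
  proof (intro equalityI subsetI)
    fix a assume "a \<in> \<Union> ?S"
    then obtain A where A: "A \<in> ?S" "a \<in> A" by blast
    then have "a \<in> carrier G" "A = proj a" using coset_eq_proj by blast+
    then show "a \<in> {a \<in> carrier G. \<Union> K \<subseteq> conj_subgroup G a H}" using A(1) iff by simp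
  next
    fix a assume "a \<in> {a \<in> carrier G. \<Union> K \<subseteq> conj_subgroup G a H}"
    then have "proj a \<in> ?S" "a \<in> proj a"
      using iff proj_self by (simp_all add: carrier_FactGroup)
    then show "a \<in> \<Union> ?S" by blast
  qed
  have cH: "card H = card N * card (proj ` H)"
    using card_Union_rcosets[OF N.subgroup_axioms, of "proj ` H"] Union_proj_image[OF H]
      subgroup.subset[OF HQ] by (simp add: carrier_eq)
  have cS: "card {a \<in> carrier G. \<Union> K \<subseteq> conj_subgroup G a H} = card N * card ?S"
    using card_Union_rcosets[OF N.subgroup_axioms, of ?S] unfolding U by (auto simp: carrier_eq)
  have "num_fixed (coset_gset Q (proj ` H)) K * int (card H) =
      int (card N) * (num_fixed (coset_gset Q (proj ` H)) K * int (card (proj ` H)))"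
    by (simp add: cH)
  also have "\<dots> = num_fixed (coset_gset G H) (\<Union> K) * int (card H)"
    unfolding Q.num_fixed_coset_gset[OF HQ subgroup.subset[OF K]] num_fixed_coset_gset[OF H(1) KG]
    by (simp add: cS)
  finally have "num_fixed (coset_gset Q (proj ` H)) K * int (card H) =
      num_fixed (coset_gset G H) (\<Union> K) * int (card H)" .
  then show ?thesis using card_subgroup_pos[OF H(1)] by simp
qed

text \<open>Otherwise \<open>N\<close>, being part of \<open>\<Union> K\<close>, would lie in a
  conjugate of \<open>H\<close> and hence in \<open>H\<close> itself.\<close>

lemma num_fixed_coset_not_above:
  assumes H: "subgroup H G" "\<not> N \<subseteq> H" and K: "subgroup K Q"
  shows "num_fixed (coset_gset G H) (\<Union> K) = 0"
proof (rule ccontr)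
  note HG = subgroup.subset[OF H(1)]
  assume "num_fixed (coset_gset G H) (\<Union> K) \<noteq> 0"
  then obtain a where "a \<in> carrier G" "\<Union> K \<subseteq> conj_subgroup G a H"
    using num_fixed_coset_nonzero_iff[OF H(1) subgroup.subset[OF preimage(1)[OF K]]] by blast
  then show False using N_subset_conj_iff[OF HG] preimage(2)[OF K] H(2) by blast
qed

section \<open>Conjugacy classes above N and the coefficients in the quotient\<close>

abbreviation classes_above :: "'a set set set" where
  "classes_above \<equiv> conj_class G ` {H \<in> D. N \<subseteq> H}"

abbreviation proj_class :: "'a set set \<Rightarrow> 'a set set set" where
  "proj_class C \<equiv> (\<lambda>L. proj ` L) ` C"

lemma proj_class_conj_class:
  assumes "H \<subseteq> carrier G"
  shows "proj_class (conj_class G H) = conj_class Q (proj ` H)"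
proof -
  have "proj_class (conj_class G H) = (\<lambda>g. conj_subgroup Q (proj g) (proj ` H)) ` carrier G"
    unfolding conj_class_def Setcompr_eq_image image_image
    using assms by (intro image_cong) (simp_all add: conj_proj_image)
  then show ?thesis
    unfolding conj_class_def Setcompr_eq_image carrier_FactGroup by (simp add: image_image)
qed

text \<open>The inverse takes unions elementwise: every member of such a class contains
  \<open>N\<close> and is recovered from its image by \<open>Union_proj_image\<close>.\<close>

lemma inj_on_proj_class: "inj_on proj_class classes_above"
proof (rule inj_on_inverseI)
  fix C assume "C \<in> classes_above"
  then obtain H where H: "H \<in> D" "N \<subseteq> H" "C = conj_class G H" by blast
  have "\<Union> (proj ` L) = L" if "L \<in> C" for L
  proof -
    obtain g where g: "g \<in> carrier G" "L = conj_subgroup G g H"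
      using \<open>L \<in> C\<close> H(3) by (auto simp: conj_class_def)
    then show ?thesis
      using Union_proj_image[of L] subgroup_conj_subgroup[OF subgroups[OF H(1)] g(1)] H(2)
        N_subset_conj_iff[OF subgroup.subset[OF subgroups[OF H(1)]] g(1)] by simp
  qed
  then show "Union ` proj_class C = C" by (simp add: image_image)
qed

lemma proj_class_image: "proj_class ` classes_above = collection_classes Q D'"
proof -
  have "proj_class ` classes_above = (\<lambda>H. conj_class Q (proj ` H)) ` {H \<in> D. N \<subseteq> H}"
    unfolding image_image[of proj_class]
    using proj_class_conj_class subgroup.subset[OF subgroups] by (intro image_cong) auto
  also have "\<dots> = conj_class Q ` D'"
    by (auto simp: quotient_collection_def)
  finally show ?thesis by (simp add: collection_classes_def)
qed

sublocale Q: subgroup_family Q D'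
  by (intro subgroup_family.intro subgroup_family_axioms.intro Q.finite_group_axioms)
    (auto simp: quotient_collection_def dest: subgroups P.subgroup_img_is_subgroup)

lemma sum_quotient_classes: "(\<Sum>C\<in>collection_classes Q D'. f C) = (\<Sum>C\<in>classes_above. f (proj_class C))"
  unfolding proj_class_image[symmetric] by (simp add: sum.reindex[OF inj_on_proj_class])

text \<open>\<open>proj_class\<close> is a bijection from the classes above \<open>N\<close> onto
  those of the quotient family, so \<open>inv_into\<close> carries the old coefficients to the new
  index set.\<close>

lemma fixed_hom_comb:
  "fixed_hom G D N (burnside_comb G D a) =
    burnside_comb Q D' (\<lambda>C. a (inv_into classes_above proj_class C))"
proof (rule Q.burnside_eqI)
  let ?b = "\<lambda>C. a (inv_into classes_above proj_class C)"
  show "fixed_hom G D N (burnside_comb G D a) \<in> carrier (burnside_ring Q)"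
    by (rule fixed_hom_ghost(1)[OF burnside_comb_carrier])
  show "burnside_comb Q D' ?b \<in> carrier (burnside_ring Q)" by (rule Q.burnside_comb_closed)
  fix K assume K: "subgroup K Q"
  note K' = preimage(1)[OF K]
  have "ghost K (burnside_comb Q D' ?b) =
      (\<Sum>C\<in>classes_above. a C * ghost K (transitive_class Q (proj_class C)))"
    by (simp add: Q.ghost_burnside_comb[OF K] sum_quotient_classes inv_into_f_f[OF inj_on_proj_class])
  also have "\<dots> = (\<Sum>C\<in>classes_above. a C * ghost (\<Union> K) (transitive_class G C))"
  proof (rule sum.cong)
    fix C assume "C \<in> classes_above"
    then obtain H where H: "H \<in> D" "N \<subseteq> H" "C = conj_class G H" by blast
    note sH = subgroups[OF H(1)]
    have "ghost K (transitive_class Q (proj_class C)) = num_fixed (coset_gset Q (proj ` H)) K"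
      using Q.ghost_transitive_class[OF P.subgroup_img_is_subgroup[OF sH] K]
      by (simp add: H(3) proj_class_conj_class[OF subgroup.subset[OF sH]])
    also have "\<dots> = ghost (\<Union> K) (transitive_class G C)"
      using num_fixed_coset_quotient[OF sH H(2) K] ghost_transitive_class[OF sH K'] H(3) by simp
    finally show "a C * ghost K (transitive_class Q (proj_class C)) =
        a C * ghost (\<Union> K) (transitive_class G C)" by simp
  qed simp
  \<comment> \<open>The sum extends to all classes, since those not above \<open>N\<close> have mark
    zero at a subgroup containing \<open>N\<close>.\<close>
  also have "\<dots> = (\<Sum>C\<in>collection_classes G D. a C * ghost (\<Union> K) (transitive_class G C))"
  proof (rule sum.mono_neutral_left)
    show "\<forall>C\<in>collection_classes G D - classes_above. a C * ghost (\<Union> K) (transitive_class G C) = 0"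
    proof
      fix C assume "C \<in> collection_classes G D - classes_above"
      then obtain H where H: "H \<in> D" "\<not> N \<subseteq> H" "C = conj_class G H"
        unfolding collection_classes_def by blast
      then show "a C * ghost (\<Union> K) (transitive_class G C) = 0"
        using num_fixed_coset_not_above[OF subgroups[OF H(1)] H(2) K]
          ghost_transitive_class[OF subgroups[OF H(1)] K'] by simp
    qed
  qed (auto simp: collection_classes_def finite_family)
  also have "\<dots> = ghost K (fixed_hom G D N (burnside_comb G D a))"
    by (simp add: ghost_burnside_comb[OF K'] fixed_hom_ghost(2)[OF burnside_comb_carrier K])
  finally show "ghost K (fixed_hom G D N (burnside_comb G D a)) = ghost K (burnside_comb Q D' ?b)"
    by simp
qed

section \<open>Cores and upper coefficient sums\<close>

lemma subgroup_core_props: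
  assumes "H \<in> D"
  shows "subgroup_core G H \<in> D" "subgroup_core G H \<lhd> G" "N \<subseteq> subgroup_core G H \<longleftrightarrow> N \<subseteq> H"
proof -
  note sH = subgroups[OF assms] and HG = subgroup.subset[OF subgroups[OF assms]]
  \<comment> \<open>The core is an intersection of finitely many conjugates, while \<open>D\<close>
    is closed under pairwise intersections only; hence the induction.\<close>
  have "\<Inter> F \<in> D" if "finite F" "F \<noteq> {}" "F \<subseteq> D" for F
    using that collection by (induction F rule: finite_ne_induct) (auto simp: collection_def)
  moreover have "conj_class G H \<subseteq> D" "finite (conj_class G H)" "conj_class G H \<noteq> {}"
    using collection assms finite_carrier conj_class_self[OF HG]
    by (auto simp: conj_class_def collection_def Setcompr_eq_image)
  ultimately show D: "subgroup_core G H \<in> D" by (simp add: subgroup_core_eq)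
  have "g \<otimes> h \<otimes> inv g \<in> subgroup_core G H"
    if g: "g \<in> carrier G" and h: "h \<in> subgroup_core G H" for g h
    unfolding subgroup_core_def
  proof
    fix a assume a: "a \<in> carrier G"
    \<comment> \<open>The core lies in every conjugate; the index is chosen so that conjugation by
      \<open>g\<close> lands in the one by \<open>a\<close>.\<close>
    have "h \<in> conj_subgroup G (inv g \<otimes> a) H" using h a g by (simp add: subgroup_core_def)
    then have "g \<otimes> h \<otimes> inv g \<in> conj_subgroup G g (conj_subgroup G (inv g \<otimes> a) H)"
      by (auto simp: conj_subgroup_eq[of g])
    then show "g \<otimes> h \<otimes> inv g \<in> conj_subgroup G a H"
      using g a HG by (simp add: conj_subgroup_comp inv_mult_cancel)
  qed
  then show "subgroup_core G H \<lhd> G"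
    using subgroups[OF D] by (simp add: normal_inv_iff)
  show "N \<subseteq> subgroup_core G H \<longleftrightarrow> N \<subseteq> H"
    using N_subset_conj_iff[OF HG] one_closed by (auto simp: subgroup_core_def)
qed

text \<open>The classes above \<open>N\<close> are sorted by their core, which is normal, in
  \<open>D\<close> and above \<open>N\<close>. Distinct cores give disjoint sets of classes, because
  the core is the intersection of the class.\<close>

lemma upper_coeffsum_comb:
  "upper_coeffsum G D N (burnside_comb G D a) = (\<Sum>C\<in>classes_above. a C)"
proof -
  let ?I = "{M \<in> D. M \<lhd> G \<and> N \<subseteq> M}" and ?A = "\<lambda>M. conj_class G ` {H \<in> D. subgroup_core G H = M}"
  have U: "(\<Union>M\<in>?I. ?A M) = classes_above"
    using subgroup_core_props by blast
  have "upper_coeffsum G D N (burnside_comb G D a) = (\<Sum>M\<in>?I. \<Sum>C\<in>?A M. a C)"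
    unfolding upper_coeffsum_def core_coeffsum_def burnside_coeff_comb
    by (intro sum.cong) (auto simp: collection_classes_def)
  also have "\<dots> = (\<Sum>C\<in>(\<Union>M\<in>?I. ?A M). a C)"
  proof (rule sum.UNION_disjoint[symmetric])
    show "\<forall>M\<in>?I. \<forall>M'\<in>?I. M \<noteq> M' \<longrightarrow> ?A M \<inter> ?A M' = {}"
      by (auto simp: subgroup_core_eq)
  qed (use finite_family in auto)
  finally show ?thesis unfolding U .
qed

lemma upper_coeffsum_eq_coeffsum:
  assumes "x \<in> carrier (partial_burnside_ring G D)"
  shows "upper_coeffsum G D N x = coeffsum Q D' (fixed_hom G D N x)"
proof -
  obtain a where a: "x = burnside_comb G D a" using partial_burnside_ringE[OF assms] .
  show ?thesis
    unfolding a upper_coeffsum_comb fixed_hom_comb Q.coeffsum_comb sum_quotient_classes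
    by (simp add: inv_into_f_f[OF inj_on_proj_class])
qed

lemma fixed_hom_carrier:
  assumes "x \<in> carrier (partial_burnside_ring G D)"
  shows "fixed_hom G D N x \<in> carrier (partial_burnside_ring Q D')"
proof -
  obtain a where a: "x = burnside_comb G D a" using partial_burnside_ringE[OF assms] .
  show ?thesis unfolding a fixed_hom_comb by (rule Q.burnside_comb_carrier)
qed

end

text \<open>Marks are multiplicative with value one at the identity, so the marks of a unit are
  invertible integers.\<close>

lemma (in subgroup_family) ghost_unit:
  assumes u: "u \<in> Units (partial_burnside_ring G D)" and K: "subgroup K G"
  shows "\<bar>ghost K u\<bar> = 1"
proof -
  obtain v where v: "u \<in> carrier (partial_burnside_ring G D)" "v \<in> carrier (partial_burnside_ring G D)"
    "u \<otimes>\<^bsub>burnside_ring G\<^esub> v = \<one>\<^bsub>burnside_ring G\<^esub>"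
    using u by (auto simp: Units_def partial_burnside_ring_def)
  \<comment> \<open>Every element is counted for the one-point set G/G, so its mark is |G| divided
    by |G|.\<close>
  have "conj_subgroup G a (carrier G) = carrier G" if "a \<in> carrier G" for a
    using that mem_conj_subgroup_iff[of "carrier G" a] conj_subgroup_subset[of "carrier G" a] by auto
  then have "{a \<in> carrier G. K \<subseteq> conj_subgroup G a (carrier G)} = carrier G"
    using subgroup.subset[OF K] by auto
  then have "num_fixed (coset_gset G (carrier G)) K = 1"
    using num_fixed_coset_gset[OF subgroup_self subgroup.subset[OF K]] card_subgroup_pos[OF subgroup_self] by simp
  then have "ghost K \<one>\<^bsub>burnside_ring G\<^esub> = 1"
    using K by (simp add: burnside_ring_def gset_class_def ghost_virtual_class finite_gset_coset
        subgroup_self finite_gset_empty)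
  moreover have "u \<in> carrier (burnside_ring G)" "v \<in> carrier (burnside_ring G)"
    using partial_burnside_ringE[OF v(1)] partial_burnside_ringE[OF v(2)] burnside_comb_closed by metis+
  ultimately have "ghost K u * ghost K v = 1"
    using burnside_mult[of u v K] K v(3) by simp
  then show ?thesis by (auto simp: zmult_eq_1_iff)
qed

theorem theorem3p4:
  fixes G :: "('g, 'm) monoid_scheme" and D :: "'g set set" and N :: "'g set"
  assumes "group G" and "finite (carrier G)"
    and "collection G D"
    and "N \<in> D" and "N \<lhd> G"
  shows "(\<forall>x\<in>carrier (partial_burnside_ring G D).
            upper_coeffsum G D N x =
              coeffsum (G Mod N) (quotient_collection G D N) (fixed_hom G D N x)) \<and>
         (\<forall>u\<in>Units (partial_burnside_ring G D).
            real_of_int (upper_coeffsum G D N u) =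
              1 / real (order (G Mod N)) *
                (\<Sum>C\<in>carrier (G Mod N).
                   real_of_int (mark (G Mod N) (quotient_collection G D N)
                                  (generate (G Mod N) {C}) (fixed_hom G D N u))) \<and>
            upper_coeffsum G D N u \<in> {-1, 0, 1})"
proof -
  interpret collection_quotient G D N
    using assms by (simp add: collection_quotient_def collection_quotient_axioms_def
        finite_group_def finite_group_axioms_def)
  have units: "real_of_int (upper_coeffsum G D N u) =
              1 / real (order Q) *
                (\<Sum>C\<in>carrier Q. real_of_int (mark Q D' (generate Q {C}) (fixed_hom G D N u))) \<and>
            upper_coeffsum G D N u \<in> {-1, 0, 1}"
    if u: "u \<in> Units (partial_burnside_ring G D)" for u
  proof -
    have uc: "u \<in> carrier (partial_burnside_ring G D)" using u by (simp add: Units_def)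
    let ?s = "upper_coeffsum G D N u" and ?v = "fixed_hom G D N u"
    have pos: "order Q > 0" using Q.order_gt_0_iff_finite Q.finite_carrier by blast
    have sum: "(\<Sum>C\<in>carrier Q. ghost (generate Q {C}) ?v) = int (order Q) * ?s"
      using Q.sum_ghost_cyclic[OF fixed_hom_carrier[OF uc]] upper_coeffsum_eq_coeffsum[OF uc] by simp
    \<comment> \<open>The marks of the image are marks of the unit \<open>u\<close> itself, at the
      preimages of cyclic subgroups.\<close>
    have "\<bar>ghost (generate Q {C}) ?v\<bar> = 1" if "C \<in> carrier Q" for C
    proof -
      have "subgroup (generate Q {C}) Q" using that by (intro Q.generate_is_subgroup) simp
      then show ?thesis using fixed_hom_ghost(2)[OF uc] ghost_unit[OF u preimage(1)] by simp
    qed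
    then have "\<bar>\<Sum>C\<in>carrier Q. ghost (generate Q {C}) ?v\<bar> \<le> (\<Sum>C\<in>carrier Q. 1)"
      by (intro order_trans[OF sum_abs] sum_mono) simp
    \<comment> \<open>The sum has one term of absolute value one for each element of the quotient.
      Cancelling the order leaves an integer of absolute value at most one.\<close>
    then have "int (order Q) * \<bar>?s\<bar> \<le> int (order Q) * 1"
      unfolding sum by (simp add: abs_mult order_def)
    then have "\<bar>?s\<bar> \<le> 1" using pos by (simp only: mult_le_cancel_left_pos of_nat_0_less_iff)
    then have "?s \<in> {-1, 0, 1}" by auto
    moreover have "(\<Sum>C\<in>carrier Q. real_of_int (mark Q D' (generate Q {C}) ?v)) = real (order Q) * real_of_int ?s"
      using arg_cong[OF sum, of real_of_int] by (simp add: mark_eq_ghost[OF fixed_hom_carrier[OF uc]])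
    ultimately show ?thesis using pos by simp
  qed
  show ?thesis
    by (intro conjI ballI units upper_coeffsum_eq_coeffsum)
qed

end
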